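(* Let $v_1,\dots,v_m\in\mathbb{R}^n$, $x\in[0,1]^m$ and $c\in\mathbb{R}^m_+$. Suppose $\sum_{i=1}^m x_i v_i v_i^T = I_n$, $\|v_i\|\le\epsilon<\tfrac18$ for all $i\in[m]$, and $c_\infty\le\epsilon^2\langle c,x\rangle$. Then there exists $z\in\{0,1\}^m$ such that \[(1-8\epsilon)I_n\preceq\sum_{i=1}^m z_i v_i v_i^T\preceq(1+8\epsilon)I_n\quad\text{and}\quad(1-8\epsilon)\langle c,x\rangle\le\langle c,z\rangle\le(1+8\epsilon)\langle c,x\rangle.\]
   Context: $\|v_i\|$ is the Euclidean norm, $c_\infty=\max_i c_i$, $\langle c,x\rangle=\sum_i c_ix_i$, and $\preceq$ is the positive semidefinite (Loewner) order. *)

theory Defs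
  imports "HOL-Analysis.Analysis"
begin

(* The rank-one matrix v v^T, as a product of an n x 1 and a 1 x n matrix. *)
definition outer_self :: "real ^ 'n \<Rightarrow> real ^ 'n ^ 'n" where
  "outer_self v = (columnvector v :: real ^ 1 ^ 'n) ** (rowvector v :: real ^ 'n ^ 1)"

(* Over the reals, symmetry does not follow from nonnegativity of the quadratic form,
   so it is part of the definition. *)
definition pos_semidef :: "real ^ 'n ^ 'n \<Rightarrow> bool" where
  "pos_semidef A \<longleftrightarrow> transpose A = A \<and> (\<forall>u. 0 \<le> u \<bullet> (A *v u))"

definition loewner_le :: "real ^ 'n ^ 'n \<Rightarrow> real ^ 'n ^ 'n \<Rightarrow> bool" (infix "\<preceq>" 50) where
  "A \<preceq> B \<longleftrightarrow> pos_semidef (B - A)"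

end

theory Submission
  imports Defs "HOL-Computational_Algebra.Fundamental_Theorem_Algebra"
begin

text \<open>
  Appending the coordinate \<open>sqrt (c\<^sub>i / \<langle>c, x\<rangle>)\<close> to \<open>v\<^sub>i\<close> turns the cost constraint into one more
  direction of a rank-one matrix discrepancy problem for vectors \<open>u\<^sub>i\<close>: find \<open>z\<close> such that
  \<open>M = \<Sum> (z\<^sub>i - x\<^sub>i) u\<^sub>i u\<^sub>i\<^sup>T\<close> has norm at most \<open>8 \<epsilon>\<close>. Following Kyng, Luh and Song, let
  \<open>z\<^sub>i\<close> be independent with mean \<open>x\<^sub>i\<close> and consider the expectation of \<open>det (t + M) det (t - M)\<close>.

  Since the determinant is affine along rank-one directions, averaging over one coordinate acts on the
  polynomial \<open>P\<close> that records the dependence on a shift \<open>z u\<^sub>i u\<^sub>i\<^sup>T\<close> as \<open>P(0) - (\<tau>/2) P''(0)\<close>, where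
  \<open>\<tau> = x\<^sub>i (1 - x\<^sub>i)\<close>. This operation preserves nonvanishing on matrices with positive definite
  imaginary part, so all conditional expectations, and all their convex combinations, are real-rooted
  in \<open>t\<close>; hence some choice of \<open>z\<close> does not exceed the largest root of the expectation. Letting the
  imaginary part tend to zero, nonvanishing also gives the Rayleigh inequality
  \<open>G \<cdot> \<partial>\<^sub>u\<partial>\<^sub>v G \<le> \<partial>\<^sub>u G \<cdot> \<partial>\<^sub>v G\<close> on real symmetric matrices, and this is what drives the barrier argument
  that bounds the largest root: it says that \<open>\<partial>\<^sub>v G / G\<close> decreases in the direction \<open>u\<close>.
\<close>

subsection \<open>Expected products of determinants\<close>

text \<open>The vector stays real while the scalar may be complex, so that one family of matrices
  serves both the real problem and the complex shifts of the stability argument.\<close>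

definition rk1 :: "'a::real_field \<Rightarrow> real ^ 'n \<Rightarrow> 'a ^ 'n ^ 'n" where
  "rk1 z u = (\<chi> i j. z * of_real (u $ i * u $ j))"

lemma rk1_nth [simp]: "rk1 z u $ i $ j = z * of_real (u $ i * u $ j)"
  by (simp add: rk1_def)

lemma rk1_add: "rk1 (y + z) u = rk1 y u + rk1 z u"
  by (simp add: vec_eq_iff distrib_right)

lemma rk1_0 [simp]: "rk1 0 u = 0" "rk1 z 0 = 0"
  by (simp_all add: vec_eq_iff)

lemma rk1_minus: "rk1 (- y) u = - rk1 y u"
  by (simp add: vec_eq_iff)

text \<open>If \<open>u $ k\<close> is nonzero, row operations clear every row of
  \<open>u u^T\<close> except the \<open>k\<close>-th. The perturbation then sits in a single row,
  and the determinant is affine in that row. The matrix \<open>A\<close> may be singular.\<close>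

lemma det_add_rk1:
  fixes A :: "'a::real_field ^ 'n ^ 'n"
  shows "\<exists>e. \<forall>z. det (A + rk1 z u) = det A + z * e"
proof (cases "u = 0")
  case True
  then show ?thesis by (intro exI[of _ 0]) simp
next
  case False
  then obtain k where k: "u $ k \<noteq> 0" by (auto simp: vec_eq_iff)
  \<comment> \<open>\<open>E\<close> subtracts \<open>u $ i / u $ k\<close> times row
    \<open>k\<close> from each other row \<open>i\<close>; hence it sends \<open>u\<close> to a
    vector supported on \<open>k\<close>.\<close>
  define E :: "'a ^ 'n ^ 'n" where
    "E = (\<chi> i j. (if i = j then 1 else 0) - (if i \<noteq> k \<and> j = k then of_real (u $ i / u $ k) else 0))"
  have Evec: "(E *v w) $ i = w $ i - (if i = k then 0 else of_real (u $ i / u $ k) * w $ k)" for w i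
  proof -
    have "(E *v w) $ i = (\<Sum>j\<in>UNIV. (if i = j then w $ j else 0)
        - (if j = k then (if i = k then 0 else of_real (u $ i / u $ k) * w $ j) else 0))"
      unfolding E_def matrix_vector_mult_def vec_lambda_beta by (rule sum.cong) auto
    then show ?thesis by (simp add: sum_subtractf)
  qed
  have "E *v w = 0 \<Longrightarrow> w = 0" for w
  proof -
    assume "E *v w = 0"
    then have z: "(E *v w) $ i = 0" for i by simp
    from z[of k] have "w $ k = 0" by (simp add: Evec)
    then have "w $ i = 0" for i using z[of i] by (cases "i = k") (simp_all add: Evec)
    then show "w = 0" by (simp add: vec_eq_iff)
  qed
  then have "invertible E"
    unfolding invertible_left_inverse matrix_left_invertible_ker by blast
  then have dE: "det E \<noteq> 0" by (simp add: invertible_det_nz)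
  define r :: "'a ^ 'n" where "r = (\<chi> j. of_real (u $ k * u $ j))"
  define G where "G = E ** A"
  have eq: "E ** (A + rk1 z u) = (\<chi> i. if i = k then G $ i + z *s r else G $ i)" for z
  proof -
    have "(E ** rk1 z u) $ i $ j = (if i = k then z * r $ j else 0)" for i j
    proof -
      have "(E ** rk1 z u) $ i $ j = z * of_real (u $ j) * (E *v (\<chi> i. of_real (u $ i))) $ i"
        by (simp add: matrix_matrix_mult_def matrix_vector_mult_def sum_distrib_left mult_ac)
      also have "\<dots> = (if i = k then z * r $ j else 0)"
        using k by (simp add: Evec r_def mult_ac)
      finally show ?thesis .
    qed
    then show ?thesis
      by (simp add: matrix_add_ldistrib vec_eq_iff G_def)
  qed
  have "det E * det (A + rk1 z u) = det E * det A + z * det (\<chi> i. if i = k then r else G $ i)" for z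
  proof -
    have "det E * det (A + rk1 z u) = det (E ** (A + rk1 z u))" by (simp add: det_mul)
    also have "\<dots> = det (\<chi> i. if i = k then G $ i else G $ i) + z * det (\<chi> i. if i = k then r else G $ i)"
      unfolding eq det_row_add det_row_mul ..
    also have "(\<chi> i. if i = k then G $ i else G $ i) = E ** A" by (simp add: G_def vec_eq_iff)
    finally show ?thesis by (simp add: det_mul)
  qed
  then have "det (A + rk1 z u) = det A + z * (det (\<chi> i. if i = k then r else G $ i) / det E)" for z
    using dE by (simp add: field_simps)
  then show ?thesis by blast
qed

text \<open>The expectation of \<open>det (A + X) det (B - X)\<close>, where \<open>X\<close> is the sum of \<open>\<xi>\<^sub>i u\<^sub>i u\<^sub>i\<^sup>T\<close> over the list
  and the \<open>\<xi>\<^sub>i\<close> are independent, equal to \<open>1 - p\<^sub>i\<close> with probability \<open>p\<^sub>i\<close> and to \<open>- p\<^sub>i\<close> otherwise.\<close>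
fun mixdet :: "('i \<Rightarrow> real) \<Rightarrow> ('i \<Rightarrow> real ^ 'n) \<Rightarrow> 'i list \<Rightarrow>
    'a::real_field ^ 'n ^ 'n \<Rightarrow> 'a ^ 'n ^ 'n \<Rightarrow> 'a" where
  "mixdet p u [] A B = det A * det B"
| "mixdet p u (i # l) A B =
     of_real (p i) * mixdet p u l (A + rk1 (1 - of_real (p i)) (u i)) (B - rk1 (1 - of_real (p i)) (u i))
     + of_real (1 - p i) * mixdet p u l (A - rk1 (of_real (p i)) (u i)) (B + rk1 (of_real (p i)) (u i))"

text \<open>Each determinant is affine in its own scalar, and averaging preserves the form. The
  scalars are kept independent because averaging moves the two arguments in opposite directions,
  whereas stability moves them together.\<close>

lemma mixdet_biaffine:
  "\<exists>a b c d. \<forall>y z. mixdet p u l (A + rk1 y v) (B + rk1 z v) = a + b * y + c * z + d * y * z"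
proof (induction l arbitrary: A B)
  case Nil
  obtain e f where "\<And>z. det (A + rk1 z v) = det A + z * e" "\<And>z. det (B + rk1 z v) = det B + z * f"
    using det_add_rk1 by metis
  then have "mixdet p u [] (A + rk1 y v) (B + rk1 z v)
      = det A * det B + e * det B * y + det A * f * z + e * f * y * z" for y z
    by (simp add: algebra_simps)
  then show ?case by blast
next
  case (Cons i l)
  let ?r = "of_real (p i) :: 'a"
  obtain a b c d where 1: "\<And>y z. mixdet p u l (A + rk1 (1 - ?r) (u i) + rk1 y v) (B - rk1 (1 - ?r) (u i) + rk1 z v)
     = a + b * y + c * z + d * y * z"
    using Cons by metis
  obtain a' b' c' d' where 2: "\<And>y z. mixdet p u l (A - rk1 ?r (u i) + rk1 y v) (B + rk1 ?r (u i) + rk1 z v)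
     = a' + b' * y + c' * z + d' * y * z"
    using Cons by metis
  have "mixdet p u (i # l) (A + rk1 y v) (B + rk1 z v) =
     (?r * a + (1 - ?r) * a') + (?r * b + (1 - ?r) * b') * y + (?r * c + (1 - ?r) * c') * z
      + (?r * d + (1 - ?r) * d') * y * z" for y z
    using 1[of y z] 2[of y z] by (simp add: algebra_simps)
  then show ?case by blast
qed

text \<open>The centered two-point average of a bi-affine function \<open>a + by + cz + dyz\<close>, evaluated on the
  antidiagonal, only sees \<open>a\<close> and the variance times \<open>d\<close>; on the diagonal the same coefficients are
  those of a quadratic polynomial.\<close>
lemma mixdet_average:
  fixes A B :: "'a::real_field ^ 'n ^ 'n" and v :: "real ^ 'n"
  obtains \<alpha> \<beta> \<gamma> where
    "\<And>z. mixdet p u l (A + rk1 z v) (B + rk1 z v) = \<alpha> + \<beta> * z + \<gamma> * z\<^sup>2"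
    "\<And>r. r * mixdet p u l (A + rk1 (1 - r) v) (B - rk1 (1 - r) v)
        + (1 - r) * mixdet p u l (A - rk1 r v) (B + rk1 r v) = \<alpha> - r * (1 - r) * \<gamma>"
proof -
  obtain a b c d where *: "\<And>y z. mixdet p u l (A + rk1 y v) (B + rk1 z v) = a + b * y + c * z + d * y * z"
    using mixdet_biaffine by metis
  show ?thesis
  proof
    show "mixdet p u l (A + rk1 z v) (B + rk1 z v) = a + (b + c) * z + d * z\<^sup>2" for z
      by (simp add: * algebra_simps power2_eq_square)
    show "r * mixdet p u l (A + rk1 (1 - r) v) (B - rk1 (1 - r) v)
        + (1 - r) * mixdet p u l (A - rk1 r v) (B + rk1 r v) = a - r * (1 - r) * d" for r
    proof -
      have 1: "mixdet p u l (A + rk1 (1 - r) v) (B - rk1 (1 - r) v)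
          = a + b * (1 - r) - c * (1 - r) - d * (1 - r) * (1 - r)"
        using *[of "1 - r" "- (1 - r)"] by (simp only: rk1_minus) (simp add: algebra_simps)
      have 2: "mixdet p u l (A - rk1 r v) (B + rk1 r v) = a - b * r + c * r - d * r * r"
        using *[of "- r" r] by (simp only: rk1_minus) simp
      show ?thesis unfolding 1 2 by (simp add: algebra_simps)
    qed
  qed
qed

subsection \<open>Stability\<close>

definition dissipative :: "complex ^ 'n ^ 'n \<Rightarrow> bool" where
  "dissipative A \<longleftrightarrow> (\<forall>w. w \<noteq> 0 \<longrightarrow> 0 < Im (\<Sum>i\<in>UNIV. cnj (w $ i) * (A *v w) $ i))"

lemma dissipative_det_nz:
  assumes "dissipative A" shows "det A \<noteq> 0"
proof -
  have "A *v w = 0 \<Longrightarrow> w = 0" for w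
    using assms by (force simp: dissipative_def)
  then have "invertible A"
    unfolding invertible_left_inverse matrix_left_invertible_ker by blast
  then show ?thesis by (simp add: invertible_det_nz)
qed

lemma rk1_form:
  "(\<Sum>i\<in>UNIV. cnj (w $ i) * (rk1 z u *v w) $ i)
     = z * of_real ((cmod (\<Sum>i\<in>UNIV. of_real (u $ i) * w $ i))\<^sup>2)"
proof -
  let ?s = "\<Sum>i\<in>UNIV. of_real (u $ i) * w $ i"
  have "(\<Sum>i\<in>UNIV. cnj (w $ i) * (rk1 z u *v w) $ i) = z * (cnj ?s * ?s)"
    by (simp add: matrix_vector_mult_def sum_distrib_left sum_distrib_right mult_ac cnj_sum)
  also have "cnj ?s * ?s = of_real ((cmod ?s)\<^sup>2)" by (simp only: complex_norm_square mult.commute)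
  finally show ?thesis .
qed

lemma dissipative_add_rk1:
  assumes "dissipative A" "0 \<le> Im z" shows "dissipative (A + rk1 z u)"
  unfolding dissipative_def
proof (intro allI impI)
  fix w :: "complex ^ 'a" assume "w \<noteq> 0"
  then have "0 < Im (\<Sum>i\<in>UNIV. cnj (w $ i) * (A *v w) $ i)"
    using assms(1) by (simp add: dissipative_def)
  moreover have "(\<Sum>i\<in>UNIV. cnj (w $ i) * ((A + rk1 z u) *v w) $ i)
     = (\<Sum>i\<in>UNIV. cnj (w $ i) * (A *v w) $ i) + (\<Sum>i\<in>UNIV. cnj (w $ i) * (rk1 z u *v w) $ i)"
    by (simp add: matrix_vector_mult_add_rdistrib distrib_left sum.distrib)
  moreover have "0 \<le> Im z * (cmod (\<Sum>i\<in>UNIV. of_real (u $ i) * w $ i))\<^sup>2"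
    using assms(2) by simp
  ultimately show "0 < Im (\<Sum>i\<in>UNIV. cnj (w $ i) * ((A + rk1 z u) *v w) $ i)"
    unfolding rk1_form by simp
qed

lemma dissipative_add_herm:
  assumes "\<And>w. Im (\<Sum>i\<in>UNIV. cnj (w $ i) * (S *v w) $ i) = 0" "0 < Im z"
  shows "dissipative (mat z + S)"
  unfolding dissipative_def
proof (intro allI impI)
  fix w :: "complex ^ 'a" assume "w \<noteq> 0"
  then obtain k where k: "w $ k \<noteq> 0" by (auto simp: vec_eq_iff)
  have "0 < (\<Sum>i\<in>UNIV. (cmod (w $ i))\<^sup>2)"
    by (rule sum_pos2[of _ k]) (use k in auto)
  moreover have "(mat z *v w) $ i = z * w $ i" for i
  proof -
    have "(mat z *v w) $ i = (\<Sum>j\<in>UNIV. if i = j then z * w $ j else 0)"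
      unfolding mat_def matrix_vector_mult_def vec_lambda_beta by (rule sum.cong) auto
    then show ?thesis by simp
  qed
  then have "(\<Sum>i\<in>UNIV. cnj (w $ i) * ((mat z + S) *v w) $ i)
     = z * of_real (\<Sum>i\<in>UNIV. (cmod (w $ i))\<^sup>2) + (\<Sum>i\<in>UNIV. cnj (w $ i) * (S *v w) $ i)"
    by (simp add: matrix_vector_mult_add_rdistrib distrib_left sum.distrib sum_distrib_left
       complex_norm_square mult_ac del: of_real_power)
  ultimately show "0 < Im (\<Sum>i\<in>UNIV. cnj (w $ i) * ((mat z + S) *v w) $ i)"
    using assms by (simp del: of_real_sum)
qed

section \<open>Quadratics without zeros in the closed upper half-plane\<close>

lemma quadratic_factor:
  fixes \<alpha> \<beta> \<gamma> :: complex
  assumes "\<gamma> \<noteq> 0"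
  obtains r s where "\<alpha> = \<gamma> * r * s" "\<beta> = - \<gamma> * (r + s)"
    "\<alpha> + \<beta> * r + \<gamma> * r\<^sup>2 = 0" "\<alpha> + \<beta> * s + \<gamma> * s\<^sup>2 = 0"
proof -
  define d where "d = csqrt (\<beta>\<^sup>2 - 4 * \<alpha> * \<gamma>)"
  define r where "r = (- \<beta> + d) / (2 * \<gamma>)"
  define s where "s = (- \<beta> - d) / (2 * \<gamma>)"
  have d: "d * d = \<beta> * \<beta> - 4 * \<alpha> * \<gamma>" by (simp add: d_def flip: power2_eq_square)
  have r: "2 * \<gamma> * r = - \<beta> + d" and s: "2 * \<gamma> * s = - \<beta> - d"
    using assms by (simp_all add: r_def s_def)
  have "4 * \<gamma> * (\<gamma> * r * s) = (2 * \<gamma> * r) * (2 * \<gamma> * s)" by simp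
  also have "\<dots> = \<beta> * \<beta> - d * d" unfolding r s by (simp add: algebra_simps)
  finally have "4 * \<gamma> * (\<gamma> * r * s) = 4 * \<gamma> * \<alpha>" by (simp add: d mult_ac)
  then have 1: "\<alpha> = \<gamma> * r * s" using assms by (metis mult_cancel_left mult_eq_0_iff zero_neq_numeral)
  have "2 * \<gamma> * (r + s) = 2 * (- \<beta>)" using r s by (simp add: distrib_left)
  then have "\<gamma> * (r + s) = - \<beta>" by simp
  then have 2: "\<beta> = - \<gamma> * (r + s)" by simp
  show ?thesis by (rule that[OF 1 2]; unfold 1 2; simp add: power2_eq_square algebra_simps)
qed

text \<open>Both roots lie in the open lower half-plane. If the difference vanished, their product
  would be \<open>\<tau> \<ge> 0\<close>, making one root a nonnegative multiple of the conjugate of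
  the other, which has nonnegative imaginary part.\<close>

lemma stable_quadratic_average_nz:
  fixes \<alpha> \<beta> \<gamma> :: complex and \<tau> :: real
  assumes nz: "\<And>z. 0 \<le> Im z \<Longrightarrow> \<alpha> + \<beta> * z + \<gamma> * z\<^sup>2 \<noteq> 0" and "0 \<le> \<tau>"
  shows "\<alpha> - of_real \<tau> * \<gamma> \<noteq> 0"
proof
  assume 0: "\<alpha> - of_real \<tau> * \<gamma> = 0"
  have "\<alpha> \<noteq> 0" using nz[of 0] by simp
  with 0 have g: "\<gamma> \<noteq> 0" by auto
  obtain r s where rs: "\<alpha> = \<gamma> * r * s" "\<alpha> + \<beta> * r + \<gamma> * r\<^sup>2 = 0" "\<alpha> + \<beta> * s + \<gamma> * s\<^sup>2 = 0"
    using quadratic_factor[OF g] by metis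
  have im: "Im r < 0" "Im s < 0" using nz[of r] nz[of s] rs by force+
  from 0 have "\<gamma> * (r * s - of_real \<tau>) = 0" unfolding rs(1) by (simp add: algebra_simps)
  with g have "r * s = of_real \<tau>" by simp
  then have re: "Re r * Re s - Im r * Im s = \<tau>" "Re r * Im s + Im r * Re s = 0"
    by (simp_all add: complex_eq_iff)
  have "\<tau> * Im r = - Im s * ((Re r)\<^sup>2 + (Im r)\<^sup>2)"
  proof -
    have "\<tau> * Im r + Im s * ((Re r)\<^sup>2 + (Im r)\<^sup>2) = Re r * (Re r * Im s + Im r * Re s)"
      unfolding re(1)[symmetric] by (simp add: algebra_simps power2_eq_square)
    then show ?thesis by (simp add: re(2))
  qed
  moreover have "0 < - Im s * ((Re r)\<^sup>2 + (Im r)\<^sup>2)"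
    using im by (intro mult_pos_pos) (auto intro: add_nonneg_pos)
  moreover have "\<tau> * Im r \<le> 0" using im \<open>0 \<le> \<tau>\<close> by (simp add: mult_nonneg_nonpos)
  ultimately show False by simp
qed

text \<open>\<open>\<beta> / \<alpha>\<close> is the logarithmic derivative at 0, the sum of
  \<open>- 1 / r\<close> over the roots \<open>r\<close>. Roots in the lower half-plane make each
  term have negative imaginary part; multiplying by the squared modulus of \<open>\<alpha>\<close>
  clears the denominator.\<close>

lemma stable_quadratic_Im_le:
  fixes \<alpha> \<beta> \<gamma> :: complex
  assumes nz: "\<And>z. 0 \<le> Im z \<Longrightarrow> \<alpha> + \<beta> * z + \<gamma> * z\<^sup>2 \<noteq> 0"
  shows "Im (\<beta> * cnj \<alpha>) \<le> 0"
proof (cases "\<gamma> = 0")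
  case True
  show ?thesis
  proof (cases "\<beta> = 0")
    case False
    define r where "r = \<alpha> / \<beta>"
    have r: "\<alpha> = r * \<beta>" using False by (simp add: r_def)
    have im: "Im (- r) < 0" using nz[of "- r"] True by (force simp: r)
    have "\<beta> * cnj \<alpha> = cnj r * (\<beta> * cnj \<beta>)" by (simp add: r)
    also have "\<beta> * cnj \<beta> = of_real ((cmod \<beta>)\<^sup>2)" by (simp only: complex_norm_square)
    finally have "Im (\<beta> * cnj \<alpha>) = - (Im r * (cmod \<beta>)\<^sup>2)" by simp
    then show ?thesis using im by simp
  qed simp
next
  case False
  obtain r s where rs: "\<alpha> = \<gamma> * r * s" "\<beta> = - \<gamma> * (r + s)"
     "\<alpha> + \<beta> * r + \<gamma> * r\<^sup>2 = 0" "\<alpha> + \<beta> * s + \<gamma> * s\<^sup>2 = 0"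
    using quadratic_factor[OF False] by metis
  have im: "Im r < 0" "Im s < 0" using nz[of r] nz[of s] rs(3,4) by force+
  have "\<beta> * cnj \<alpha> = - (\<gamma> * cnj \<gamma>) * ((r * cnj r) * cnj s + (s * cnj s) * cnj r)"
    unfolding rs(1,2) by (simp add: algebra_simps)
  also have "\<dots> = - of_real ((cmod \<gamma>)\<^sup>2) * (of_real ((cmod r)\<^sup>2) * cnj s + of_real ((cmod s)\<^sup>2) * cnj r)"
    by (simp only: complex_norm_square)
  finally have eq: "\<beta> * cnj \<alpha> = - of_real ((cmod \<gamma>)\<^sup>2) * (of_real ((cmod r)\<^sup>2) * cnj s + of_real ((cmod s)\<^sup>2) * cnj r)" .
  have "Im (\<beta> * cnj \<alpha>) = (cmod \<gamma>)\<^sup>2 * ((cmod r)\<^sup>2 * Im s + (cmod s)\<^sup>2 * Im r)"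
    unfolding eq by (simp add: algebra_simps)
  also have "\<dots> \<le> 0"
    using im by (intro mult_nonneg_nonpos add_nonpos_nonpos) auto
  finally show ?thesis .
qed

text \<open>Shifting both arguments by \<open>z v v^T\<close> with \<open>Im z \<ge> 0\<close> keeps
  them dissipative, so the quadratic in \<open>z\<close> meets the hypothesis of
  \<open>stable_quadratic_average_nz\<close>. The weight \<open>r\<close> is independent of
  \<open>p\<close>; letting it vary later yields all convex combinations of two branches.\<close>

lemma average_dissipative_nz:
  assumes nz: "\<And>A B. dissipative A \<Longrightarrow> dissipative B \<Longrightarrow> mixdet p u l A B \<noteq> 0"
    and "0 \<le> r" "r \<le> 1" "dissipative A" "dissipative B"
  shows "of_real r * mixdet p u l (A + rk1 (1 - of_real r) v) (B - rk1 (1 - of_real r) v)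
    + (1 - of_real r) * mixdet p u l (A - rk1 (of_real r) v) (B + rk1 (of_real r) v) \<noteq> 0"
proof -
  obtain \<alpha> \<beta> \<gamma> where *: "\<And>z. mixdet p u l (A + rk1 z v) (B + rk1 z v) = \<alpha> + \<beta> * z + \<gamma> * z\<^sup>2"
    and av: "\<And>r. r * mixdet p u l (A + rk1 (1 - r) v) (B - rk1 (1 - r) v)
      + (1 - r) * mixdet p u l (A - rk1 r v) (B + rk1 r v) = \<alpha> - r * (1 - r) * \<gamma>"
    using mixdet_average[where p = p and u = u and l = l and A = A and B = B and v = v] by blast
  have "\<alpha> + \<beta> * z + \<gamma> * z\<^sup>2 \<noteq> 0" if "0 \<le> Im z" for z
    unfolding *[symmetric] by (intro nz dissipative_add_rk1 that assms)
  from stable_quadratic_average_nz[OF this, where \<tau> = "r * (1 - r)"] assms(2,3)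
  show ?thesis unfolding av by simp
qed

lemma mixdet_dissipative_nz:
  assumes "\<And>i. 0 \<le> p i \<and> p i \<le> 1" "dissipative A" "dissipative B"
  shows "mixdet p u l A B \<noteq> 0"
  using assms(2,3)
proof (induction l arbitrary: A B)
  case Nil
  then show ?case by (simp add: dissipative_det_nz)
next
  case (Cons i l)
  then show ?case
    using average_dissipative_nz[of p u l "p i" A B "u i"] assms(1)[of i] by simp
qed

subsection \<open>The Rayleigh inequality\<close>

lemma quadratic_interpolation:
  fixes g :: "'a::real_field \<Rightarrow> 'a"
  assumes "\<And>z. g z = a + b * z + c * z\<^sup>2"
  shows "a = g 0" "b = (g 1 - g (- 1)) / 2" "c = (g 1 + g (- 1)) / 2 - g 0"
  by (simp_all add: assms field_simps)

text \<open>Three values determine a quadratic, so coefficients read off at real arguments are valid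
  at complex ones.\<close>

lemma quadratic_ext:
  fixes g :: "complex \<Rightarrow> complex"
  assumes "\<And>z. g z = a + b * z + c * z\<^sup>2"
    and "\<And>t. g (of_real t) = a' + b' * of_real t + c' * (of_real t)\<^sup>2"
  shows "g z = a' + b' * z + c' * z\<^sup>2"
proof -
  have 0: "g 0 = a'" and 1: "g 1 = a' + b' + c'" and 2: "g (- 1) = a' - b' + c'"
    using assms(2)[of 0] assms(2)[of 1] assms(2)[of "- 1"] by simp_all
  have "a = a'" "b = b'" "c = c'"
    unfolding quadratic_interpolation[of g a b c, OF assms(1)] 0 1 2 by (simp_all add: field_simps)
  then show ?thesis using assms(1) by simp
qed

lemma mixdet_quadratic:
  obtains a b c where "\<And>z. mixdet p u l (A + rk1 z v) (B + rk1 z v) = a + b * z + c * z\<^sup>2"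
  by (rule mixdet_average[of p u l A v B]) blast

text \<open>The function is quadratic in each variable separately; interpolating in \<open>t\<close>
  at 0, 1 and -1 turns this into one joint polynomial.\<close>

lemma mixdet_biquadratic:
  fixes A B :: "'a::real_field ^ 'n ^ 'n" and v w :: "real ^ 'n"
  obtains c00 c10 c20 c01 c11 c21 c02 c12 c22 where
    "\<And>s t. mixdet p u l (A + rk1 s v + rk1 t w) (B + rk1 s v + rk1 t w)
      = (c00 + c10 * s + c20 * s\<^sup>2) + (c01 + c11 * s + c21 * s\<^sup>2) * t + (c02 + c12 * s + c22 * s\<^sup>2) * t\<^sup>2"
proof -
  define h where "h s t = mixdet p u l (A + rk1 s v + rk1 t w) (B + rk1 s v + rk1 t w)" for s t
  have "\<exists>a b c. \<forall>s. h s t = a + b * s + c * s\<^sup>2" for t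
  proof -
    obtain a b c where "\<And>s. mixdet p u l (A + rk1 t w + rk1 s v) (B + rk1 t w + rk1 s v) = a + b * s + c * s\<^sup>2"
      using mixdet_quadratic by blast
    then have "h s t = a + b * s + c * s\<^sup>2" for s
      unfolding h_def by (simp add: add_ac)
    then show ?thesis by blast
  qed
  then obtain a b c where s: "\<And>s t. h s t = a t + b t * s + c t * s\<^sup>2" by metis
  have "\<exists>a b c. \<forall>t. h s t = a + b * t + c * t\<^sup>2" for s
  proof -
    obtain a b c where "\<And>t. h s t = a + b * t + c * t\<^sup>2"
      unfolding h_def using mixdet_quadratic by metis
    then show ?thesis by blast
  qed
  then obtain a' b' c' where t: "\<And>s t. h s t = a' s + b' s * t + c' s * t\<^sup>2" by metis
  have "a' s = h s 0" "b' s = (h s 1 - h s (- 1)) / 2" "c' s = (h s 1 + h s (- 1)) / 2 - h s 0" for s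
    using quadratic_interpolation[of "h s", OF t] by auto
  then have ht: "h s t = h s 0 + (h s 1 - h s (- 1)) / 2 * t + ((h s 1 + h s (- 1)) / 2 - h s 0) * t\<^sup>2" for s t
    using t[of s t] by simp
  show ?thesis
  proof
    show "mixdet p u l (A + rk1 s v + rk1 t w) (B + rk1 s v + rk1 t w) =
      (a 0 + b 0 * s + c 0 * s\<^sup>2)
      + ((a 1 - a (- 1)) / 2 + (b 1 - b (- 1)) / 2 * s + (c 1 - c (- 1)) / 2 * s\<^sup>2) * t
      + (((a 1 + a (- 1)) / 2 - a 0) + ((b 1 + b (- 1)) / 2 - b 0) * s + ((c 1 + c (- 1)) / 2 - c 0) * s\<^sup>2) * t\<^sup>2"
      for s t
      unfolding h_def[symmetric] by (subst ht) (simp add: s add_divide_distrib diff_divide_distrib algebra_simps)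
  qed
qed

section \<open>Real matrices inside complex ones, and continuity\<close>

definition cmat :: "real ^ 'n ^ 'n \<Rightarrow> complex ^ 'n ^ 'n" where
  "cmat A = (\<chi> i j. of_real (A $ i $ j))"

lemma cmat_nth [simp]: "cmat A $ i $ j = of_real (A $ i $ j)"
  by (simp add: cmat_def)

lemma cmat_add: "cmat (A + B) = cmat A + cmat B"
  and cmat_diff: "cmat (A - B) = cmat A - cmat B"
  and cmat_rk1: "cmat (rk1 t v) = rk1 (of_real t) v"
  and cmat_mat: "cmat (mat t) = mat (of_real t)"
  by (simp_all add: vec_eq_iff mat_def)

lemma det_cmat: "det (cmat A) = of_real (det A)"
  by (simp add: det_def)

lemma mixdet_cmat: "mixdet p u l (cmat A) (cmat B) = of_real (mixdet p u l A B)"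
proof (induction l arbitrary: A B)
  case Nil
  then show ?case by (simp add: det_cmat)
next
  case (Cons i l)
  have "cmat A + rk1 (1 - of_real r) v = cmat (A + rk1 (1 - r) v)"
    "cmat A - rk1 (1 - of_real r) v = cmat (A - rk1 (1 - r) v)"
    "cmat A + rk1 (of_real r) v = cmat (A + rk1 r v)"
    "cmat A - rk1 (of_real r) v = cmat (A - rk1 r v)" for A r and v :: "real ^ 'b"
    by (simp_all add: cmat_add cmat_diff cmat_rk1)
  then show ?case by (simp add: Cons)
qed

lemma continuous_mixdet:
  fixes M N :: "real \<Rightarrow> complex ^ 'n ^ 'n"
  assumes "continuous_on UNIV M" "continuous_on UNIV N"
  shows "continuous_on UNIV (\<lambda>x. mixdet p u l (M x) (N x))"
  using assms
proof (induction l arbitrary: M N)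
  case Nil
  then show ?case
    by (auto simp: det_def intro!: continuous_intros)
next
  case (Cons i l)
  then show ?case by (simp del: of_real_diff) (intro continuous_intros Cons.IH)
qed

lemma cmat_form_real:
  assumes "transpose S = S"
  shows "Im (\<Sum>i\<in>UNIV. cnj (w $ i) * (cmat S *v w) $ i) = 0"
proof -
  have S: "S $ i $ j = S $ j $ i" for i j
    using assms by (metis transpose_def vec_lambda_beta)
  let ?q = "\<Sum>i\<in>UNIV. \<Sum>j\<in>UNIV. cnj (w $ i) * (of_real (S $ i $ j) * w $ j)"
  have "cnj ?q = (\<Sum>i\<in>UNIV. \<Sum>j\<in>UNIV. cnj (w $ j) * (of_real (S $ j $ i) * w $ i))"
    by (simp add: S mult_ac)
  also have "\<dots> = ?q" by (rule sum.swap)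
  finally have "cnj ?q = ?q" .
  then have "Im ?q = 0" by (simp only: complex_is_Real_iff[symmetric] Reals_cnj_iff)
  then show ?thesis by (simp add: matrix_vector_mult_def sum_distrib_left)
qed

lemma continuous_mat_ii: "continuous_on UNIV (\<lambda>\<eta>. mat (\<i> * of_real \<eta>) :: complex ^ 'n ^ 'n)"
proof -
  have "(\<lambda>\<eta>. mat (\<i> * of_real \<eta>) :: complex ^ 'n ^ 'n)
      = (\<lambda>\<eta>. \<chi> i j. if i = j then \<i> * of_real \<eta> else 0)"
    by (simp add: mat_def)
  moreover have "continuous_on UNIV (\<lambda>\<eta>. \<chi> i j :: 'n. if i = j then \<i> * of_real \<eta> else (0 :: complex))"
  proof (intro continuous_on_vec_lambda)
    show "continuous_on UNIV (\<lambda>\<eta>. if i = j then \<i> * of_real \<eta> else (0 :: complex))" for i j :: 'n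
      by (cases "i = j") (auto intro!: continuous_intros)
  qed
  ultimately show ?thesis by (simp only:)
qed

text \<open>\<open>c00\<close>, \<open>c10\<close>, \<open>c01\<close>, \<open>c11\<close> are the
  value, the two first derivatives and the mixed derivative at \<open>A\<close>. For the imaginary
  shift \<open>s = i y\<close> with \<open>y \<ge> 0\<close>, stability makes the imaginary part of
  the \<open>t\<close>-derivative times the conjugate value nonpositive. This quantity is
  \<open>y (c00 c11 - c10 c01)\<close> plus a multiple of \<open>y^3\<close>, so small
  \<open>y\<close> decides the sign.\<close>

lemma mixdet_rayleigh:
  fixes A :: "real ^ 'n ^ 'n"
  assumes p: "\<And>i. 0 \<le> p i \<and> p i \<le> 1" and sym: "transpose A = A"
    and h: "\<And>s t. mixdet p u l (A + rk1 s v + rk1 t w) (A + rk1 s v + rk1 t w)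
      = (c00 + c10 * s + c20 * s\<^sup>2) + (c01 + c11 * s + c21 * s\<^sup>2) * t + (c02 + c12 * s + c22 * s\<^sup>2) * t\<^sup>2"
  shows "c00 * c11 \<le> c10 * c01"
proof -
  define H where "H s t = mixdet p u l (cmat A + rk1 s v + rk1 t w) (cmat A + rk1 s v + rk1 t w)" for s t
  have 1: "H (of_real s) (of_real t) = (c00 + c10 * s + c20 * s\<^sup>2) + (c01 + c11 * s + c21 * s\<^sup>2) * t
      + (c02 + c12 * s + c22 * s\<^sup>2) * t\<^sup>2" for s t :: real
    unfolding H_def cmat_rk1[symmetric] cmat_add[symmetric] mixdet_cmat h ..
  \<comment> \<open>The coefficient formula is extended from real to complex arguments one variable
    at a time, first \<open>t\<close>, then \<open>s\<close>.\<close>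
  have 2: "H (of_real s) (t :: complex) = (c00 + c10 * s + c20 * s\<^sup>2) + (c01 + c11 * s + c21 * s\<^sup>2) * t
      + (c02 + c12 * s + c22 * s\<^sup>2) * t\<^sup>2" for s :: real and t :: complex
  proof -
    obtain a b c where "\<And>z. H (of_real s) z = a + b * z + c * z\<^sup>2"
      unfolding H_def using mixdet_quadratic by metis
    then show ?thesis by (rule quadratic_ext) (simp add: 1)
  qed
  have H: "H (s :: complex) (t :: complex) = (c00 + c01 * t + c02 * t\<^sup>2) + (c10 + c11 * t + c12 * t\<^sup>2) * s
      + (c20 + c21 * t + c22 * t\<^sup>2) * s\<^sup>2" for s t :: complex
  proof -
    obtain a b c where "\<And>z. mixdet p u l (cmat A + rk1 t w + rk1 z v) (cmat A + rk1 t w + rk1 z v)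
        = a + b * z + c * z\<^sup>2"
      using mixdet_quadratic by metis
    then have "\<And>z. H z t = a + b * z + c * z\<^sup>2"
      unfolding H_def by (simp add: add_ac)
    then show ?thesis by (rule quadratic_ext) (simp add: 2 algebra_simps)
  qed
  \<comment> \<open>For real symmetric \<open>A\<close> the shift \<open>i y v v^T\<close> alone
    need not give a dissipative matrix. The extra \<open>i \<eta>\<close> on the diagonal does so
    for \<open>\<eta> > 0\<close>, and continuity then allows \<open>\<eta>\<close> to tend to
    0.\<close>
  define K where "K \<eta> y t = mixdet p u l (mat (\<i> * of_real \<eta>) + cmat A + rk1 (\<i> * of_real y) v + rk1 t w)
      (mat (\<i> * of_real \<eta>) + cmat A + rk1 (\<i> * of_real y) v + rk1 t w)" for \<eta> y :: real and t
  have K0: "K 0 y t = H (\<i> * of_real y) t" for y t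
    by (simp add: K_def H_def)
  have Kcont: "continuous_on UNIV (\<lambda>\<eta>. K \<eta> y t)" for y t
    unfolding K_def by (intro continuous_mixdet continuous_intros continuous_mat_ii)
  have Kpos: "Im ((K \<eta> y 1 - K \<eta> y (- 1)) * cnj (K \<eta> y 0)) \<le> 0" if "0 < \<eta>" "0 \<le> y" for \<eta> y
  proof -
    obtain a b c where abc: "\<And>z. K \<eta> y z = a + b * z + c * z\<^sup>2"
      unfolding K_def using mixdet_quadratic by metis
    have "dissipative (mat (\<i> * of_real \<eta>) + cmat A)"
      using cmat_form_real[OF sym] that by (intro dissipative_add_herm) auto
    then have "a + b * z + c * z\<^sup>2 \<noteq> 0" if "0 \<le> Im z" for z
      unfolding abc[symmetric] K_def
      using that \<open>0 \<le> y\<close> by (intro mixdet_dissipative_nz p dissipative_add_rk1) auto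
    then have "Im (b * cnj a) \<le> 0" by (rule stable_quadratic_Im_le)
    moreover have "a = K \<eta> y 0" "K \<eta> y 1 - K \<eta> y (- 1) = 2 * b"
      by (simp_all add: abc)
    ultimately have "Im ((K \<eta> y 1 - K \<eta> y (- 1)) * cnj (K \<eta> y 0)) = 2 * Im (b * cnj a)" by (simp add: algebra_simps)
    then show ?thesis using \<open>Im (b * cnj a) \<le> 0\<close> by linarith
  qed
  have "Im ((H (\<i> * of_real y) 1 - H (\<i> * of_real y) (- 1)) * cnj (H (\<i> * of_real y) 0)) \<le> 0"
    if "0 \<le> y" for y
  proof -
    have "continuous_on UNIV (\<lambda>\<eta>. Im ((K \<eta> y 1 - K \<eta> y (- 1)) * cnj (K \<eta> y 0)))"
      by (intro continuous_intros Kcont)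
    then have "(\<lambda>\<eta>. Im ((K \<eta> y 1 - K \<eta> y (- 1)) * cnj (K \<eta> y 0)))
        \<midarrow>0\<rightarrow> Im ((K 0 y 1 - K 0 y (- 1)) * cnj (K 0 y 0))"
      by (simp add: continuous_on_eq_continuous_at isCont_def)
    then have "((\<lambda>\<eta>. Im ((K \<eta> y 1 - K \<eta> y (- 1)) * cnj (K \<eta> y 0)))
        \<longlongrightarrow> Im ((K 0 y 1 - K 0 y (- 1)) * cnj (K 0 y 0))) (at_right 0)"
      by (rule filterlim_mono[OF _ order_refl]) (simp add: at_le)
    moreover have "eventually (\<lambda>\<eta>. Im ((K \<eta> y 1 - K \<eta> y (- 1)) * cnj (K \<eta> y 0)) \<le> 0) (at_right 0)"
      using eventually_at_right_less[of 0] by eventually_elim (use Kpos that in auto)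
    ultimately have "Im ((K 0 y 1 - K 0 y (- 1)) * cnj (K 0 y 0)) \<le> 0"
      by (rule tendsto_upperbound) simp
    then show ?thesis by (simp add: K0)
  qed
  moreover have "Im ((H (\<i> * of_real y) 1 - H (\<i> * of_real y) (- 1)) * cnj (H (\<i> * of_real y) 0))
      = 2 * y * ((c00 * c11 - c10 * c01) + y\<^sup>2 * (c10 * c21 - c11 * c20))" for y
    unfolding H by (simp add: algebra_simps power2_eq_square)
  ultimately have le: "2 * y * ((c00 * c11 - c10 * c01) + y\<^sup>2 * (c10 * c21 - c11 * c20)) \<le> 0" if "0 \<le> y" for y
    using that by metis
  show ?thesis
  proof (rule ccontr)
    define D where "D = c00 * c11 - c10 * c01"
    define C where "C = c10 * c21 - c11 * c20"
    assume "\<not> ?thesis"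
    then have D: "0 < D" by (simp add: D_def)
    \<comment> \<open>The second bound gives \<open>y (\<bar>C\<bar> + 1) \<le> D / 2\<close> and
      the first gives \<open>y^2 \<le> y\<close>, so the cubic term cannot outweigh
      \<open>D\<close>.\<close>
    define y where "y = min 1 (D / (2 * (\<bar>C\<bar> + 1)))"
    have y: "0 < y" "y \<le> 1" "y \<le> D / (2 * (\<bar>C\<bar> + 1))"
      using D by (auto simp: y_def)
    then have "y * (\<bar>C\<bar> + 1) \<le> D / 2" by (simp add: field_simps)
    moreover have "y\<^sup>2 * \<bar>C\<bar> \<le> y * (\<bar>C\<bar> + 1)"
      using y by (intro mult_mono) (auto simp: power2_eq_square mult_left_le)
    moreover have "- (y\<^sup>2 * \<bar>C\<bar>) \<le> y\<^sup>2 * C"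
      by (metis abs_ge_minus_self abs_mult abs_power2 minus_le_iff)
    ultimately have "0 < D + y\<^sup>2 * C" using D by linarith
    then have "0 < 2 * y * (D + y\<^sup>2 * C)" using y by simp
    then show False using le[of y] y unfolding D_def C_def by linarith
  qed
qed

subsection \<open>The barrier argument\<close>

text \<open>\<open>?E\<close> is the Bezoutian \<open>(N t * P s - N s * P t) / (t - s)\<close>. By
  \<open>wr\<close> the quotient \<open>N / P\<close> is nonincreasing where \<open>P\<close> is
  positive, which gives the sign off the diagonal; on the diagonal the claim is \<open>wr\<close>
  itself.\<close>

lemma antitone_quotient_bezout:
  fixes \<alpha> \<beta> \<gamma> n0 n1 n2 :: real
  defines "P \<equiv> \<lambda>z. \<alpha> + \<beta> * z + \<gamma> * z\<^sup>2" and "N \<equiv> \<lambda>z. n0 + n1 * z + n2 * z\<^sup>2"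
  assumes pos: "\<And>z. m \<le> z \<Longrightarrow> 0 < P z"
    and wr: "\<And>z. P z * (n1 + 2 * n2 * z) \<le> (\<beta> + 2 * \<gamma> * z) * N z"
    and "m \<le> s" "m \<le> t"
  shows "(n1 * \<alpha> - n0 * \<beta>) + (s + t) * (n2 * \<alpha> - n0 * \<gamma>) + s * t * (n2 * \<beta> - n1 * \<gamma>) \<le> 0"
    (is "?E s t \<le> 0")
proof -
  have less: "?E s t \<le> 0" if "m \<le> s" "s < t" for s t
  proof -
    have "N t / P t \<le> N s / P s"
    proof (rule DERIV_nonpos_imp_nonincreasing[of s t])
      fix z assume z: "s \<le> z" "z \<le> t"
      have Pz: "0 < P z" using pos z that by simp
      have "((\<lambda>z. N z / P z) has_real_derivative
          ((n1 + 2 * n2 * z) * P z - N z * (\<beta> + 2 * \<gamma> * z)) / (P z * P z)) (at z)"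
        using Pz unfolding N_def P_def
        by (auto intro!: derivative_eq_intros simp: power2_eq_square algebra_simps)
      moreover have "((n1 + 2 * n2 * z) * P z - N z * (\<beta> + 2 * \<gamma> * z)) / (P z * P z) \<le> 0"
        using wr[of z] Pz by (intro divide_nonpos_pos) (simp_all add: mult.commute)
      ultimately show "\<exists>y. ((\<lambda>z. N z / P z) has_real_derivative y) (at z) \<and> y \<le> 0" by blast
    qed (use that in simp)
    then have "N t * P s \<le> N s * P t"
      using pos[of s] pos[of t] that by (simp add: field_simps)
    moreover have "N t * P s - N s * P t = (t - s) * ?E s t"
      unfolding N_def P_def by (simp add: algebra_simps power2_eq_square)
    ultimately have "(t - s) * ?E s t \<le> 0" by linarith
    then show ?thesis using that by (simp add: mult_le_0_iff)
  qed
  consider "s < t" | "t < s" | "s = t" by linarith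
  then show ?thesis
  proof cases
    case 1
    then show ?thesis using less \<open>m \<le> s\<close> by simp
  next
    case 2
    then show ?thesis using less[of t s] \<open>m \<le> t\<close> by (simp add: mult_ac add_ac)
  next
    case 3
    have "?E t t = P t * (n1 + 2 * n2 * t) - (\<beta> + 2 * \<gamma> * t) * N t"
      unfolding N_def P_def by (simp add: algebra_simps power2_eq_square)
    then show ?thesis using wr[of t] 3 by simp
  qed
qed

text \<open>With \<open>s = - \<delta>\<close> and \<open>t = - \<tau> / \<delta>\<close>, the difference of the two sides of the second claim is
  \<open>\<delta>\<close> times the Bezoutian of \<open>N\<close> and \<open>P\<close> at \<open>(s, t)\<close>.\<close>
lemma quadratic_barrier:
  fixes \<alpha> \<beta> \<gamma> n0 n1 n2 \<tau> \<delta> \<kappa> :: real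
  defines "P \<equiv> \<lambda>z. \<alpha> + \<beta> * z + \<gamma> * z\<^sup>2" and "N \<equiv> \<lambda>z. n0 + n1 * z + n2 * z\<^sup>2"
  assumes pos: "\<And>z. - \<delta> \<le> z \<Longrightarrow> 0 < P z"
    and root: "\<beta> - 2 * \<gamma> * \<delta> \<le> \<kappa> * P (- \<delta>)"
    and rr: "\<And>z. 2 * \<gamma> * P z \<le> (\<beta> + 2 * \<gamma> * z)\<^sup>2"
    and wr: "\<And>z. P z * (n1 + 2 * n2 * z) \<le> (\<beta> + 2 * \<gamma> * z) * N z"
    and "0 < \<delta>" "0 \<le> \<tau>" "0 \<le> \<kappa>" "\<kappa> * \<tau> < \<delta>"
  shows "0 < \<alpha> - \<tau> * \<gamma>" and "(n0 - \<tau> * n2) * P (- \<delta>) \<le> N (- \<delta>) * (\<alpha> - \<tau> * \<gamma>)"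
proof -
  have gamma: "0 \<le> \<gamma>"
  proof (rule ccontr)
    assume "\<not> 0 \<le> \<gamma>"
    then have g: "\<gamma> < 0" by simp
    define z where "z = 1 + (\<bar>\<alpha>\<bar> + \<bar>\<beta>\<bar>) / (- \<gamma>)"
    have z: "1 \<le> z" using g by (simp add: z_def divide_nonneg_neg)
    have "\<gamma> * z = \<gamma> - (\<bar>\<alpha>\<bar> + \<bar>\<beta>\<bar>)" using g by (simp add: z_def field_simps)
    then have neg: "\<bar>\<alpha>\<bar> + \<bar>\<beta>\<bar> + \<gamma> * z < 0" using g by simp
    have "\<alpha> \<le> \<bar>\<alpha>\<bar> * z" using mult_left_mono[OF z, of "\<bar>\<alpha>\<bar>"] by simp
    moreover have "\<beta> * z \<le> \<bar>\<beta>\<bar> * z" using z by (intro mult_right_mono) auto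
    ultimately have "P z \<le> z * (\<bar>\<alpha>\<bar> + \<bar>\<beta>\<bar> + \<gamma> * z)"
      unfolding P_def by (simp add: algebra_simps power2_eq_square)
    also have "\<dots> < 0" using neg z by (intro mult_pos_neg) auto
    finally show False using pos[of z] z \<open>0 < \<delta>\<close> by simp
  qed
  \<comment> \<open>The Bezoutian will be taken at \<open>- \<delta>\<close> and
    \<open>- \<tau> / \<delta>\<close>, so positivity of \<open>P\<close> is needed down to the
    smaller of the two. Their product is \<open>\<tau>\<close>, whence
    \<open>\<tau> \<le> m * m\<close>.\<close>
  define m where "m = max \<delta> (\<tau> / \<delta>)"
  have m: "\<delta> \<le> m" "\<tau> / \<delta> \<le> m" "0 < m" using \<open>0 < \<delta>\<close> by (auto simp: m_def)
  have "\<tau> = \<delta> * (\<tau> / \<delta>)" using \<open>0 < \<delta>\<close> by simp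
  also have "\<dots> \<le> m * m" using m \<open>0 < \<delta>\<close> \<open>0 \<le> \<tau>\<close> by (intro mult_mono) auto
  finally have mm: "\<tau> \<le> m * m" .
  \<comment> \<open>Left of \<open>- \<delta>\<close> the convex \<open>P\<close> lies above its
    tangent there. By \<open>root\<close> the tangent falls at relative rate at most
    \<open>\<kappa>\<close>, too slowly to reach zero within distance
    \<open>\<tau> / \<delta>\<close>.\<close>
  have posm: "0 < P z" if "- m \<le> z" for z
  proof (cases "- \<delta> \<le> z")
    case False
    then have "m = \<tau> / \<delta>" using that by (auto simp: m_def max_def split: if_splits)
    define r where "r = - \<delta> - z"
    have r: "0 \<le> r" "r \<le> \<tau> / \<delta>" using that False \<open>m = \<tau> / \<delta>\<close> \<open>0 < \<delta>\<close> by (auto simp: r_def)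
    have "\<kappa> * r \<le> \<kappa> * (\<tau> / \<delta>)" using r \<open>0 \<le> \<kappa>\<close> by (intro mult_left_mono)
    also have "\<dots> < 1" using \<open>\<kappa> * \<tau> < \<delta>\<close> \<open>0 < \<delta>\<close> by simp
    finally have "0 < (1 - \<kappa> * r) * P (- \<delta>)" using pos[of "- \<delta>"] by simp
    also have "\<dots> \<le> P (- \<delta>) - r * (\<beta> - 2 * \<gamma> * \<delta>)"
      using mult_left_mono[OF root r(1)] by (simp add: algebra_simps)
    also have "\<dots> \<le> P (- \<delta>) - r * (\<beta> - 2 * \<gamma> * \<delta>) + \<gamma> * r\<^sup>2" using gamma by simp
    also have "\<dots> = P z" by (simp add: P_def r_def algebra_simps power2_eq_square)
    finally show ?thesis .
  qed (rule pos)
  show "0 < \<alpha> - \<tau> * \<gamma>"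
  proof (cases "\<gamma> = 0")
    case True
    then show ?thesis using posm[of 0] m by (simp add: P_def)
  next
    case False
    with gamma have g: "0 < \<gamma>" by simp
    \<comment> \<open>At the vertex \<open>rr\<close> forces \<open>P \<le> 0\<close>, so the vertex
      lies left of \<open>- m\<close>. Combined with \<open>P (- m) > 0\<close> this gives
      \<open>\<alpha> > \<gamma> * m * m\<close>, which is at least
      \<open>\<gamma> * \<tau>\<close>.\<close>
    define z where "z = - \<beta> / (2 * \<gamma>)"
    have "\<beta> + 2 * \<gamma> * z = 0" using g by (simp add: z_def)
    then have "P z \<le> 0" using rr[of z] g by (simp add: mult_le_0_iff)
    then have "z < - m" using posm[of z] by force
    then have "2 * \<gamma> * m < \<beta>" using g by (simp add: z_def field_simps)
    then have "2 * \<gamma> * m * m < \<beta> * m" using m by (intro mult_strict_right_mono)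
    moreover have "0 < P (- m)" by (rule posm) simp
    then have "\<beta> * m < \<alpha> + \<gamma> * (m * m)" by (simp add: P_def power2_eq_square)
    moreover have "\<gamma> * \<tau> \<le> \<gamma> * (m * m)" using mm g by simp
    ultimately show ?thesis by (simp add: algebra_simps)
  qed
  have "(n1 * \<alpha> - n0 * \<beta>) + (- \<delta> + - (\<tau> / \<delta>)) * (n2 * \<alpha> - n0 * \<gamma>)
      + - \<delta> * - (\<tau> / \<delta>) * (n2 * \<beta> - n1 * \<gamma>) \<le> 0" (is "?E \<le> 0")
    by (rule antitone_quotient_bezout[of "- m"]) (use posm wr m in \<open>auto simp: P_def N_def\<close>)
  then have "\<delta> * ?E \<le> 0" using \<open>0 < \<delta>\<close> by (simp add: mult_le_0_iff)
  moreover have "\<delta> * ?E = (n0 - \<tau> * n2) * P (- \<delta>) - N (- \<delta>) * (\<alpha> - \<tau> * \<gamma>)"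
    using \<open>0 < \<delta>\<close> unfolding P_def N_def by (simp add: field_simps power2_eq_square)
  ultimately show "(n0 - \<tau> * n2) * P (- \<delta>) \<le> N (- \<delta>) * (\<alpha> - \<tau> * \<gamma>)" by linarith
qed

section \<open>Quadratic forms, the Loewner order and positive determinants\<close>

lemma rk1_mult_vec: "rk1 s u *v w = (s * (u \<bullet> w)) *\<^sub>R u" for s :: real
  by (simp add: vec_eq_iff matrix_vector_mult_def inner_vec_def sum_distrib_left sum_distrib_right mult_ac)

lemma rk1_quadratic_form: "w \<bullet> (rk1 s u *v w) = s * (u \<bullet> w)\<^sup>2" for s :: real
  by (simp add: rk1_mult_vec power2_eq_square inner_commute)

lemma transpose_add: "transpose (A + B) = transpose A + transpose B"
  and transpose_diff: "transpose (A - B) = transpose A - transpose B"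
  and transpose_rk1: "transpose (rk1 z u) = rk1 z u"
  by (simp_all add: transpose_def vec_eq_iff mult.commute)

lemma mat_mult_vec: "mat c *v w = c *\<^sub>R w" for c :: real and w :: "real ^ 'a"
proof -
  have "mat c = c *\<^sub>R (mat 1 :: real ^ 'a ^ 'a)" by (simp add: mat_def vec_eq_iff)
  then show ?thesis by (simp flip: scaleR_matrix_vector_assoc)
qed

lemma pos_semidef_add: "pos_semidef A \<Longrightarrow> pos_semidef B \<Longrightarrow> pos_semidef (A + B)"
  by (simp add: pos_semidef_def transpose_add matrix_vector_mult_add_rdistrib inner_add_right)

lemma pos_semidef_rk1: "0 \<le> s \<Longrightarrow> pos_semidef (rk1 s u)"
  by (simp add: pos_semidef_def transpose_rk1 rk1_quadratic_form)

lemma loewner_le_trans: "A \<preceq> B \<Longrightarrow> B \<preceq> C \<Longrightarrow> A \<preceq> C"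
  using pos_semidef_add[of "B - A" "C - B"] by (simp add: loewner_le_def)

text \<open>On the segment from the identity to \<open>A\<close> every matrix has a positive
  definite form, so the determinant cannot change sign.\<close>

lemma pos_def_det_pos:
  fixes A :: "real ^ 'n ^ 'n"
  assumes "\<And>w. w \<noteq> 0 \<Longrightarrow> 0 < w \<bullet> (A *v w)"
  shows "0 < det A"
proof -
  define M where "M t = (1 - t) *\<^sub>R mat 1 + t *\<^sub>R A" for t :: real
  have nz: "det (M t) \<noteq> 0" if "0 \<le> t" "t \<le> 1" for t
  proof -
    have "0 < w \<bullet> (M t *v w)" if "w \<noteq> 0" for w
    proof -
      have "w \<bullet> (M t *v w) = (1 - t) * (w \<bullet> w) + t * (w \<bullet> (A *v w))"
        by (simp add: M_def matrix_vector_mult_add_rdistrib inner_add_right flip: scaleR_matrix_vector_assoc)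
      also have "0 < \<dots>"
      proof (cases "t = 0")
        case False
        then show ?thesis
          using assms[OF that] \<open>0 \<le> t\<close> \<open>t \<le> 1\<close> by (intro add_nonneg_pos) auto
      qed (use that in simp)
      finally show ?thesis .
    qed
    then have "M t *v w = 0 \<Longrightarrow> w = 0" for w by force
    then have "invertible (M t)"
      unfolding invertible_left_inverse matrix_left_invertible_ker by blast
    then show ?thesis by (simp add: invertible_det_nz)
  qed
  have cont: "continuous_on {0..1} (\<lambda>t. det (M t))"
    unfolding det_def M_def by (auto intro!: continuous_intros)
  show ?thesis
  proof (rule ccontr)
    assume "\<not> 0 < det A"
    then have "det (M 1) \<le> 0" "0 \<le> det (M 0)" by (simp_all add: M_def)
    then obtain t where "0 \<le> t" "t \<le> 1" "det (M t) = 0"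
      using IVT2'[of "\<lambda>t. det (M t)" 1 0 0] cont by auto
    with nz show False by blast
  qed
qed

text \<open>The half difference is the derivative of \<open>t \<mapsto> mixdet p u l (A + t v v\<^sup>T) (A + t v v\<^sup>T)\<close> at \<open>0\<close>,
  since this function is a quadratic polynomial.\<close>
definition barrier :: "('i \<Rightarrow> real) \<Rightarrow> ('i \<Rightarrow> real ^ 'n) \<Rightarrow> 'i list \<Rightarrow> real ^ 'n ^ 'n \<Rightarrow> real \<Rightarrow> bool" where
  "barrier p u l Y k \<longleftrightarrow> (\<forall>A. Y \<preceq> A \<longrightarrow> 0 < mixdet p u l A A \<and>
     (\<forall>v. (mixdet p u l (A + rk1 1 v) (A + rk1 1 v) - mixdet p u l (A + rk1 (- 1) v) (A + rk1 (- 1) v)) / 2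
        \<le> k * (v \<bullet> v) * mixdet p u l A A))"

text \<open>For the square of the determinant the logarithmic derivative along \<open>v v^T\<close>
  is \<open>2 e / det A\<close>. As \<open>A - s v v^T\<close> stays positive definite while
  \<open>s (v \<bullet> v) < c\<close>, the zero \<open>s = det A / e\<close> cannot occur earlier,
  which bounds \<open>e\<close>.\<close>

lemma barrier_Nil:
  fixes Y :: "real ^ 'n ^ 'n"
  assumes "mat c \<preceq> Y" "0 < c"
  shows "barrier p u [] Y (2 / c)"
  unfolding barrier_def
proof (intro allI impI conjI)
  fix A assume "Y \<preceq> A"
  with assms have "mat c \<preceq> A" using loewner_le_trans by blast
  then have "0 \<le> w \<bullet> ((A - mat c) *v w)" for w
    by (simp add: loewner_le_def pos_semidef_def)
  then have ge: "c * (w \<bullet> w) \<le> w \<bullet> (A *v w)" for w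
    by (simp add: matrix_vector_mult_diff_rdistrib inner_diff_right mat_mult_vec)
  have det: "0 < det (A + rk1 (- s) v)" if "s * (v \<bullet> v) < c" "0 \<le> s" for s v
  proof (rule pos_def_det_pos)
    fix w :: "real ^ 'n" assume "w \<noteq> 0"
    have "s * (v \<bullet> w)\<^sup>2 \<le> s * ((v \<bullet> v) * (w \<bullet> w))"
      using that by (intro mult_left_mono Cauchy_Schwarz_ineq)
    also have "\<dots> < c * (w \<bullet> w)"
      using that \<open>w \<noteq> 0\<close> by (simp flip: mult.assoc)
    finally show "0 < w \<bullet> ((A + rk1 (- s) v) *v w)"
      using ge[of w] by (simp add: matrix_vector_mult_add_rdistrib inner_add_right rk1_quadratic_form)
  qed
  have pos: "0 < det A" using det[of 0 0] assms by simp
  then show "0 < mixdet p u [] A A" by simp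
  fix v
  obtain e where e: "\<And>z. det (A + rk1 z v) = det A + z * e" using det_add_rk1 by blast
  have "e * c \<le> (v \<bullet> v) * det A"
  proof (rule ccontr)
    assume "\<not> ?thesis"
    then have *: "(v \<bullet> v) * det A < e * c" by simp
    then have "0 < e * c" using pos by (metis inner_ge_zero less_imp_le mult_nonneg_nonneg le_less_trans)
    then have "0 < e" using \<open>0 < c\<close> by (simp add: zero_less_mult_iff)
    then have "0 < det (A + rk1 (- (det A / e)) v)"
      using * pos by (intro det) (simp_all add: field_simps)
    then show False using \<open>0 < e\<close> by (simp add: e)
  qed
  then have "e \<le> (v \<bullet> v) / c * det A" using \<open>0 < c\<close> by (simp add: field_simps)
  then have "2 * det A * e \<le> 2 * det A * ((v \<bullet> v) / c * det A)"
    using pos by (intro mult_left_mono) auto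
  then show "(mixdet p u [] (A + rk1 1 v) (A + rk1 1 v) - mixdet p u [] (A + rk1 (- 1) v) (A + rk1 (- 1) v)) / 2
        \<le> 2 / c * (v \<bullet> v) * mixdet p u [] A A"
    by (simp add: e algebra_simps)
qed

lemma mixdet_Cons_trivial:
  assumes "p i * (1 - p i) = 0 \<or> u i = 0"
  shows "mixdet p u (i # l) A B = mixdet p u l A B"
  using assms by (auto simp: algebra_simps)

lemma mixdet_Cons_coeffs:
  fixes A B :: "real ^ 'n ^ 'n"
  assumes "\<And>z. mixdet p u l (A + rk1 z (u i)) (B + rk1 z (u i)) = \<alpha> + \<beta> * z + \<gamma> * z\<^sup>2"
  shows "mixdet p u (i # l) A B = \<alpha> - p i * (1 - p i) * \<gamma>"
proof -
  obtain \<alpha>' \<beta>' \<gamma>' where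
    1: "\<And>z. mixdet p u l (A + rk1 z (u i)) (B + rk1 z (u i)) = \<alpha>' + \<beta>' * z + \<gamma>' * z\<^sup>2"
    and 2: "\<And>r. r * mixdet p u l (A + rk1 (1 - r) (u i)) (B - rk1 (1 - r) (u i))
        + (1 - r) * mixdet p u l (A - rk1 r (u i)) (B + rk1 r (u i)) = \<alpha>' - r * (1 - r) * \<gamma>'"
    using mixdet_average[where p = p and u = u and l = l and A = A and B = B and v = "u i"] by blast
  have "\<alpha>' = \<alpha>" "\<gamma>' = \<gamma>"
    using quadratic_interpolation(1,3)[OF 1] quadratic_interpolation(1,3)[OF assms] by simp_all
  then show ?thesis using 2[of "p i"] by simp
qed

text \<open>Averaging over one more coordinate costs a shift of the reference matrix by
  \<open>\<delta>\<close> times \<open>u_i u_i^T\<close>, while \<open>k\<close> survives. Along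
  \<open>A + z u_i u_i^T\<close> let \<open>P\<close> be the old value and \<open>N\<close> its
  \<open>v\<close>-derivative. The old barrier controls both at \<open>z = - \<delta>\<close>; the
  Rayleigh inequality for the pairs \<open>(u_i, u_i)\<close> and \<open>(u_i, v)\<close> supplies
  the other hypotheses of \<open>quadratic_barrier\<close>.\<close>

lemma barrier_Cons:
  fixes u :: "'i \<Rightarrow> real ^ 'n"
  assumes p: "\<And>i. 0 \<le> p i \<and> p i \<le> 1" and Y: "transpose Y = Y" and bar: "barrier p u l Y k"
    and "0 \<le> k" "0 < \<delta>" "k * (p i * (1 - p i)) * (u i \<bullet> u i) < \<delta>"
  shows "barrier p u (i # l) (Y + rk1 \<delta> (u i)) k"
  unfolding barrier_def
proof (intro allI impI)
  fix A :: "real ^ 'n ^ 'n" assume A: "Y + rk1 \<delta> (u i) \<preceq> A"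
  define \<tau> where "\<tau> = p i * (1 - p i)"
  have \<tau>: "0 \<le> \<tau>" using p[of i] by (simp add: \<tau>_def)
  have sym: "transpose (A + rk1 z (u i)) = A + rk1 z (u i)" for z
  proof -
    have "transpose (A - (Y + rk1 \<delta> (u i))) = A - (Y + rk1 \<delta> (u i))"
      using A by (simp add: loewner_le_def pos_semidef_def)
    then show ?thesis by (simp add: transpose_diff transpose_add transpose_rk1 Y)
  qed
  have YA: "Y \<preceq> A + rk1 z (u i)" if "- \<delta> \<le> z" for z
  proof -
    have "pos_semidef ((A - (Y + rk1 \<delta> (u i))) + rk1 (z + \<delta>) (u i))"
      using A that by (intro pos_semidef_add pos_semidef_rk1) (simp_all add: loewner_le_def)
    then show ?thesis by (simp add: loewner_le_def rk1_add algebra_simps)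
  qed
  have *: "0 < mixdet p u (i # l) A A \<and>
     (mixdet p u (i # l) (A + rk1 1 v) (A + rk1 1 v) - mixdet p u (i # l) (A + rk1 (- 1) v) (A + rk1 (- 1) v)) / 2
        \<le> k * (v \<bullet> v) * mixdet p u (i # l) A A" for v
  proof -
    obtain c00 c10 c20 c01 c11 c21 c02 c12 c22 where
      h: "\<And>s t. mixdet p u l (A + rk1 s (u i) + rk1 t v) (A + rk1 s (u i) + rk1 t v)
      = (c00 + c10 * s + c20 * s\<^sup>2) + (c01 + c11 * s + c21 * s\<^sup>2) * t + (c02 + c12 * s + c22 * s\<^sup>2) * t\<^sup>2"
      using mixdet_biquadratic[of p u l A "u i" v A] by blast
    define P where "P z = c00 + c10 * z + c20 * z\<^sup>2" for z
    define N where "N z = c01 + c11 * z + c21 * z\<^sup>2" for z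
    have hP: "mixdet p u l (A + rk1 z (u i)) (A + rk1 z (u i)) = P z" for z
      using h[of z 0] by (simp add: P_def)
    have pos: "0 < P z" if "- \<delta> \<le> z" for z
      using bar YA[OF that] unfolding barrier_def hP[symmetric] by blast
    have "N (- \<delta>) = (mixdet p u l (A + rk1 (- \<delta>) (u i) + rk1 1 v) (A + rk1 (- \<delta>) (u i) + rk1 1 v)
        - mixdet p u l (A + rk1 (- \<delta>) (u i) + rk1 (- 1) v) (A + rk1 (- \<delta>) (u i) + rk1 (- 1) v)) / 2"
      unfolding h N_def by simp
    also have "\<dots> \<le> k * (v \<bullet> v) * P (- \<delta>)"
      using bar YA[of "- \<delta>"] unfolding barrier_def hP[symmetric] by blast
    finally have N: "N (- \<delta>) \<le> k * (v \<bullet> v) * P (- \<delta>)" .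
    have "c10 - 2 * c20 * \<delta> = (mixdet p u l (A + rk1 (- \<delta>) (u i) + rk1 1 (u i)) (A + rk1 (- \<delta>) (u i) + rk1 1 (u i))
        - mixdet p u l (A + rk1 (- \<delta>) (u i) + rk1 (- 1) (u i)) (A + rk1 (- \<delta>) (u i) + rk1 (- 1) (u i))) / 2"
      unfolding add.assoc rk1_add[symmetric] hP P_def by (simp add: field_simps power2_eq_square)
    also have "\<dots> \<le> k * (u i \<bullet> u i) * P (- \<delta>)"
      using bar YA[of "- \<delta>"] unfolding barrier_def hP[symmetric] by blast
    finally have root: "c10 - 2 * c20 * \<delta> \<le> k * (u i \<bullet> u i) * P (- \<delta>)" .
    have rr: "2 * c20 * P z \<le> (c10 + 2 * c20 * z)\<^sup>2" for z
    proof -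
      have "P z * (2 * c20) \<le> (c10 + 2 * c20 * z) * (c10 + 2 * c20 * z)"
      proof (rule mixdet_rayleigh[OF p sym[of z], where v = "u i" and w = "u i"])
        show "mixdet p u l (A + rk1 z (u i) + rk1 s (u i) + rk1 t (u i)) (A + rk1 z (u i) + rk1 s (u i) + rk1 t (u i))
          = P z + (c10 + 2 * c20 * z) * s + c20 * s\<^sup>2 + (c10 + 2 * c20 * z + 2 * c20 * s + 0 * s\<^sup>2) * t
            + (c20 + 0 * s + 0 * s\<^sup>2) * t\<^sup>2" for s t
          unfolding add.assoc rk1_add[symmetric] hP P_def by (simp add: algebra_simps power2_eq_square)
      qed
      then show ?thesis by (simp add: power2_eq_square mult_ac)
    qed
    have wr: "P z * (c11 + 2 * c21 * z) \<le> (c10 + 2 * c20 * z) * N z" for z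
    proof (rule mixdet_rayleigh[OF p sym[of z], where v = "u i" and w = v])
      have 1: "A + rk1 z (u i) + rk1 s (u i) + rk1 t v = A + rk1 (z + s) (u i) + rk1 t v" for s t
        by (simp add: rk1_add add.assoc)
      show "mixdet p u l (A + rk1 z (u i) + rk1 s (u i) + rk1 t v) (A + rk1 z (u i) + rk1 s (u i) + rk1 t v)
        = P z + (c10 + 2 * c20 * z) * s + c20 * s\<^sup>2 + (N z + (c11 + 2 * c21 * z) * s + c21 * s\<^sup>2) * t
          + ((c02 + c12 * z + c22 * z\<^sup>2) + (c12 + 2 * c22 * z) * s + c22 * s\<^sup>2) * t\<^sup>2" for s t
        unfolding 1 h P_def N_def by (simp add: algebra_simps power2_eq_square)
    qed
    have kt: "k * (u i \<bullet> u i) * \<tau> < \<delta>" using assms(6) by (simp add: \<tau>_def mult_ac)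
    have new_pos: "0 < c00 - \<tau> * c20"
      and bez: "(c01 - \<tau> * c21) * P (- \<delta>) \<le> N (- \<delta>) * (c00 - \<tau> * c20)"
      using quadratic_barrier[where \<alpha> = c00 and \<beta> = c10 and \<gamma> = c20 and ?n0.0 = c01 and ?n1.0 = c11 and ?n2.0 = c21
          and \<delta> = \<delta> and \<kappa> = "k * (u i \<bullet> u i)" and \<tau> = \<tau>]
        pos root rr wr \<open>0 < \<delta>\<close> \<tau> \<open>0 \<le> k\<close> kt
      unfolding P_def N_def by auto
    note bez
    also have "N (- \<delta>) * (c00 - \<tau> * c20) \<le> k * (v \<bullet> v) * P (- \<delta>) * (c00 - \<tau> * c20)"
      using N new_pos by (intro mult_right_mono) auto
    also have "\<dots> = (k * (v \<bullet> v) * (c00 - \<tau> * c20)) * P (- \<delta>)"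
      by (simp add: mult_ac)
    finally have N': "c01 - \<tau> * c21 \<le> k * (v \<bullet> v) * (c00 - \<tau> * c20)"
      using pos[of "- \<delta>"] by (simp add: mult_le_cancel_right)
    have new: "mixdet p u (i # l) (A + rk1 t v) (A + rk1 t v)
        = (c00 + c01 * t + c02 * t\<^sup>2) - \<tau> * (c20 + c21 * t + c22 * t\<^sup>2)" for t
      unfolding \<tau>_def
    proof (rule mixdet_Cons_coeffs)
      have 1: "A + rk1 t v + rk1 z (u i) = A + rk1 z (u i) + rk1 t v" for z
        by (simp add: add_ac)
      show "mixdet p u l (A + rk1 t v + rk1 z (u i)) (A + rk1 t v + rk1 z (u i))
        = c00 + c01 * t + c02 * t\<^sup>2 + (c10 + c11 * t + c12 * t\<^sup>2) * z + (c20 + c21 * t + c22 * t\<^sup>2) * z\<^sup>2" for z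
        unfolding 1 h by (simp add: algebra_simps)
    qed
    have new0: "mixdet p u (i # l) A A = c00 - \<tau> * c20" using new[of 0] by simp
    show ?thesis
      unfolding new new0 using N' new_pos by (simp add: field_simps)
  qed
  then show "0 < mixdet p u (i # l) A A \<and>
     (\<forall>v. (mixdet p u (i # l) (A + rk1 1 v) (A + rk1 1 v) - mixdet p u (i # l) (A + rk1 (- 1) v) (A + rk1 (- 1) v)) / 2
        \<le> k * (v \<bullet> v) * mixdet p u (i # l) A A)" by blast
qed

text \<open>With this shift \<open>\<delta>\<close> the condition of \<open>barrier_Cons\<close>
  reads \<open>k \<sigma> \<delta> < \<delta>\<close>. Coordinates of zero variance or zero vector
  have \<open>\<delta> = 0\<close> and leave the expectation unchanged.\<close>

lemma barrier_list:
  fixes u :: "'i \<Rightarrow> real ^ 'n"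
  assumes p: "\<And>i. 0 \<le> p i \<and> p i \<le> 1" and "transpose Y = Y" and "barrier p u [] Y k"
    and "0 \<le> k" "k * \<sigma> < 1" "0 < \<sigma>"
  shows "barrier p u l (Y + (\<Sum>i\<leftarrow>l. rk1 (p i * (1 - p i) * (u i \<bullet> u i) / \<sigma>) (u i))) k
    \<and> transpose (Y + (\<Sum>i\<leftarrow>l. rk1 (p i * (1 - p i) * (u i \<bullet> u i) / \<sigma>) (u i)))
        = Y + (\<Sum>i\<leftarrow>l. rk1 (p i * (1 - p i) * (u i \<bullet> u i) / \<sigma>) (u i))"
proof (induction l)
  case Nil
  then show ?case using assms by simp
next
  case (Cons i l)
  define Z where "Z = Y + (\<Sum>i\<leftarrow>l. rk1 (p i * (1 - p i) * (u i \<bullet> u i) / \<sigma>) (u i))"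
  define \<delta> where "\<delta> = p i * (1 - p i) * (u i \<bullet> u i) / \<sigma>"
  have Z: "barrier p u l Z k" "transpose Z = Z" using Cons by (simp_all add: Z_def)
  have "barrier p u (i # l) (Z + rk1 \<delta> (u i)) k"
  proof (cases "p i * (1 - p i) = 0 \<or> u i = 0")
    case True
    then have "rk1 \<delta> (u i) = 0" by (auto simp: \<delta>_def)
    then show ?thesis using Z(1) unfolding barrier_def by (simp only: mixdet_Cons_trivial[of p i u, OF True]) simp
  next
    case False
    then have "0 < p i * (1 - p i) * (u i \<bullet> u i)"
      using p[of i] by (intro mult_pos_pos) (auto simp: less_le)
    then have \<delta>: "0 < \<delta>" using assms(6) by (simp add: \<delta>_def)
    moreover have "k * \<sigma> * \<delta> < 1 * \<delta>" using assms(5) \<delta> by (intro mult_strict_right_mono)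
    moreover have "k * \<sigma> * \<delta> = k * (p i * (1 - p i)) * (u i \<bullet> u i)"
      using assms(6) by (simp add: \<delta>_def)
    ultimately show ?thesis
      using assms(4) by (intro barrier_Cons p Z) simp_all
  qed
  moreover have "Y + (\<Sum>i\<leftarrow>i # l. rk1 (p i * (1 - p i) * (u i \<bullet> u i) / \<sigma>) (u i)) = Z + rk1 \<delta> (u i)"
    by (simp add: Z_def \<delta>_def add_ac)
  ultimately show ?case using Z(2) by (simp add: transpose_add transpose_rk1)
qed

text \<open>The variance bound says that all shifts together are at most \<open>\<sigma>\<close>
  times the identity. Starting at \<open>mat b\<close> minus these shifts, which dominates
  \<open>mat (b - \<sigma>)\<close>, the barrier constant is \<open>k = 2 / (b - \<sigma>)\<close>,
  and \<open>k \<sigma> < 1\<close> is exactly \<open>3 \<sigma> < b\<close>.\<close>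

lemma mixdet_mat_pos:
  fixes u :: "'i \<Rightarrow> real ^ 'n"
  assumes p: "\<And>i. 0 \<le> p i \<and> p i \<le> 1" and "0 < \<sigma>" "3 * \<sigma> < b"
    and var: "\<And>w. (\<Sum>i\<leftarrow>l. p i * (1 - p i) * (u i \<bullet> u i) * (u i \<bullet> w)\<^sup>2) \<le> \<sigma>\<^sup>2 * (w \<bullet> w)"
  shows "0 < mixdet p u l (mat b) (mat b)"
proof -
  define D where "D l = (\<Sum>i\<leftarrow>l. rk1 (p i * (1 - p i) * (u i \<bullet> u i) / \<sigma>) (u i))" for l
  have form: "\<sigma> * (w \<bullet> (D l *v w)) = (\<Sum>i\<leftarrow>l. p i * (1 - p i) * (u i \<bullet> u i) * (u i \<bullet> w)\<^sup>2)" for w l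
    using \<open>0 < \<sigma>\<close>
    by (induction l) (simp_all add: D_def matrix_vector_mult_add_rdistrib inner_add_right
       rk1_quadratic_form distrib_left)
  have sym: "transpose (D l) = D l" for l
    by (induction l) (simp_all add: D_def transpose_add transpose_rk1, simp add: transpose_def vec_eq_iff)
  have sym': "transpose (mat b - D l) = mat b - D l"
    by (simp add: transpose_diff sym)
  have "w \<bullet> (D l *v w) \<le> \<sigma> * (w \<bullet> w)" for w
  proof -
    have "\<sigma> * (w \<bullet> (D l *v w)) \<le> \<sigma> * (\<sigma> * (w \<bullet> w))"
      unfolding form using var[of w] by (simp add: power2_eq_square)
    then show ?thesis using \<open>0 < \<sigma>\<close> by simp
  qed
  then have "mat (b - \<sigma>) \<preceq> mat b - D l"
    unfolding loewner_le_def pos_semidef_def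
    by (simp add: transpose_diff sym matrix_vector_mult_diff_rdistrib inner_diff_right mat_mult_vec
        left_diff_distrib)
  then have "barrier p u [] (mat b - D l) (2 / (b - \<sigma>))"
    using assms(2,3) by (intro barrier_Nil) simp_all
  then have "barrier p u l (mat b - D l + D l) (2 / (b - \<sigma>))"
    using assms(2,3) barrier_list[where p = p, OF p sym', where u = u and k = "2 / (b - \<sigma>)" and \<sigma> = \<sigma> and l = l]
    unfolding D_def[symmetric] by (simp add: field_simps)
  then have "barrier p u l (mat b) (2 / (b - \<sigma>))" by simp
  moreover have "mat b \<preceq> mat b"
    by (simp add: loewner_le_def pos_semidef_def) (simp add: transpose_def vec_eq_iff)
  ultimately show ?thesis unfolding barrier_def by blast
qed

subsection \<open>Real-rooted segments and the choice of signs\<close>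

definition mcnj :: "complex ^ 'n ^ 'n \<Rightarrow> complex ^ 'n ^ 'n" where
  "mcnj A = (\<chi> i j. cnj (A $ i $ j))"

lemma mcnj_simps: "mcnj (A + B) = mcnj A + mcnj B" "mcnj (A - B) = mcnj A - mcnj B"
  "mcnj (rk1 z u) = rk1 (cnj z) u" "mcnj (mat z) = mat (cnj z)" "mcnj (cmat S) = cmat S"
  by (simp_all add: mcnj_def vec_eq_iff mat_def)

lemma mixdet_mcnj: "mixdet p u l (mcnj A) (mcnj B) = cnj (mixdet p u l A B)"
proof (induction l arbitrary: A B)
  case Nil
  then show ?case by (simp add: det_def mcnj_def)
next
  case (Cons i l)
  have "mcnj A + rk1 (1 - of_real r) v = mcnj (A + rk1 (1 - of_real r) v)"
    "mcnj A - rk1 (1 - of_real r) v = mcnj (A - rk1 (1 - of_real r) v)"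
    "mcnj A + rk1 (of_real r) v = mcnj (A + rk1 (of_real r) v)"
    "mcnj A - rk1 (of_real r) v = mcnj (A - rk1 (of_real r) v)" for A r and v :: "real ^ 'b"
    by (simp_all add: mcnj_simps)
  then show ?case by (simp add: Cons)
qed

text \<open>In the Leibniz expansion only the identity permutation reaches degree
  \<open>CARD('n)\<close>.\<close>

lemma det_char_poly:
  fixes A :: "'a::field_char_0 ^ 'n ^ 'n"
  shows "\<exists>Q. degree Q \<le> CARD('n) \<and> coeff Q CARD('n) = 1 \<and> (\<forall>z. poly Q z = det (mat z + A))"
proof -
  define M :: "'a poly ^ 'n ^ 'n" where "M = (\<chi> i j. if i = j then [:A $ i $ j, 1:] else [:A $ i $ j:])"
  define P where "P q = (\<Prod>i\<in>UNIV. M $ i $ q i)" for q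
  have det: "det M = (\<Sum>q | q permutes UNIV. of_int (sign q) * P q)"
    by (simp add: det_def P_def)
  have P_id: "degree (P id) = CARD('n)" "coeff (P id) CARD('n) = 1"
  proof -
    show *: "degree (P id) = CARD('n)"
      unfolding P_def by (subst degree_prod_sum_eq) (simp_all add: M_def)
    have "lead_coeff (P id) = 1"
      unfolding P_def by (subst lead_coeff_prod) (simp add: M_def)
    then show "coeff (P id) CARD('n) = 1" by (simp add: *)
  qed
  have P_deg: "degree (P q) < CARD('n)" if "q \<noteq> id" for q
  proof -
    obtain k where k: "q k \<noteq> k" using \<open>q \<noteq> id\<close> by (auto simp: fun_eq_iff)
    have "degree (P q) \<le> (\<Sum>i\<in>UNIV. degree (M $ i $ q i))"
      unfolding P_def using degree_prod_sum_le[of UNIV "\<lambda>i. M $ i $ q i"] by (simp add: comp_def)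
    also have "\<dots> < (\<Sum>i\<in>(UNIV :: 'n set). 1)"
      by (rule sum_strict_mono_ex1) (use k in \<open>auto simp: M_def intro!: exI[of _ k]\<close>)
    finally show ?thesis by simp
  qed
  have sgn: "of_int (sign q) * r = smult (of_int (sign q)) r" for q :: "'n \<Rightarrow> 'n" and r :: "'a poly"
    by (simp add: sign_def)
  have "degree (det M) \<le> CARD('n)"
    unfolding det sgn
  proof (rule degree_sum_le)
    fix q
    have "degree (P q) \<le> CARD('n)" using P_id P_deg[of q] by (cases "q = id") auto
    then show "degree (smult (of_int (sign q)) (P q)) \<le> CARD('n)"
      using degree_smult_le le_trans by blast
  qed simp
  moreover have "coeff (det M) CARD('n) = 1"
  proof -
    have "coeff (det M) CARD('n) = (\<Sum>q | q permutes (UNIV :: 'n set). if q = id then 1 else 0)"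
      unfolding det sgn coeff_sum
      by (rule sum.cong) (auto simp: P_id coeff_eq_0[OF P_deg])
    then show ?thesis by (simp add: permutes_id)
  qed
  moreover have "poly (det M) z = det (mat z + A)" for z
  proof -
    have "poly (M $ i $ j) z = (mat z + A) $ i $ j" for i j
      by (simp add: M_def mat_def)
    then show ?thesis
      unfolding det sgn poly_sum poly_smult P_def poly_prod by (simp add: det_def)
  qed
  ultimately show ?thesis by blast
qed

lemma mixdet_monic_poly:
  fixes A B :: "'a::real_field ^ 'n ^ 'n"
  shows "\<exists>Q. degree Q \<le> 2 * CARD('n) \<and> coeff Q (2 * CARD('n)) = 1 \<and>
    (\<forall>z. poly Q z = mixdet p u l (mat z + A) (mat z + B))"
proof (induction l arbitrary: A B)
  case Nil
  obtain Q R where Q: "degree Q \<le> CARD('n)" "coeff Q CARD('n) = 1" "\<And>z. poly Q z = det (mat z + A)"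
    and R: "degree R \<le> CARD('n)" "coeff R CARD('n) = 1" "\<And>z. poly R z = det (mat z + B)"
    using det_char_poly by meson
  have "degree Q = CARD('n)" "degree R = CARD('n)"
    using Q R by (auto intro!: antisym le_degree)
  then have "degree (Q * R) \<le> 2 * CARD('n)" "coeff (Q * R) (2 * CARD('n)) = 1"
    using degree_mult_le[of Q R] coeff_mult_degree_sum[of Q R] Q(2) R(2) by (simp_all add: mult_2)
  then show ?case using Q(3) R(3) by (intro exI[of _ "Q * R"]) simp
next
  case (Cons i l)
  let ?r = "of_real (p i) :: 'a"
  obtain Q R where Q: "degree Q \<le> 2 * CARD('n)" "coeff Q (2 * CARD('n)) = 1"
     "\<And>z. poly Q z = mixdet p u l (mat z + (A + rk1 (1 - ?r) (u i))) (mat z + (B - rk1 (1 - ?r) (u i)))"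
    and R: "degree R \<le> 2 * CARD('n)" "coeff R (2 * CARD('n)) = 1"
     "\<And>z. poly R z = mixdet p u l (mat z + (A - rk1 ?r (u i))) (mat z + (B + rk1 ?r (u i)))"
    using Cons by meson
  define P where "P = smult ?r Q + smult (1 - ?r) R"
  have "degree P \<le> 2 * CARD('n)"
    unfolding P_def using Q(1) R(1) by (intro degree_add_le) (auto intro: order_trans[OF degree_smult_le])
  moreover have "coeff P (2 * CARD('n)) = 1"
    by (simp add: P_def Q R)
  moreover have "poly P z = mixdet p u (i # l) (mat z + A) (mat z + B)" for z
    by (simp add: P_def Q(3) R(3) algebra_simps)
  ultimately show ?case by blast
qed

lemma monic_factor:
  fixes Q :: "complex poly"
  assumes "degree Q \<le> Suc n" "coeff Q (Suc n) = 1"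
  obtains r R where "Q = [:- r, 1:] * R" "degree R \<le> n" "coeff R n = 1"
proof -
  have d: "degree Q = Suc n" using assms by (auto intro!: antisym le_degree)
  then have "\<not> constant (poly Q)" by (simp add: constant_degree)
  then obtain r where "poly Q r = 0" using fundamental_theorem_of_algebra by blast
  then obtain R where R: "Q = [:- r, 1:] * R" by (auto simp: poly_eq_0_iff_dvd elim: dvdE)
  with d have "R \<noteq> 0" by auto
  with d R have "degree R = n" by (simp add: degree_mult_eq del: mult_pCons_left)
  moreover have "lead_coeff R = 1"
    using assms(2) d by (metis R lead_coeff_mult lead_coeff_pCons(1) lead_coeff_1 one_pCons mult_1 pCons_eq_0_iff zero_neq_one)
  ultimately show ?thesis using that R by auto
qed

lemma real_rooted_coeffs_real:
  fixes Q :: "complex poly"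
  assumes "degree Q \<le> n" "coeff Q n = 1" "\<And>z. poly Q z = 0 \<Longrightarrow> Im z = 0"
  shows "Im (coeff Q k) = 0"
  using assms
proof (induction n arbitrary: Q k)
  case 0
  then show ?case by (cases k) (auto simp: coeff_eq_0)
next
  case (Suc n)
  obtain r R where R: "Q = [:- r, 1:] * R" "degree R \<le> n" "coeff R n = 1"
    using monic_factor Suc.prems by metis
  have "Im r = 0" by (rule Suc.prems) (simp add: R)
  moreover have "Im (coeff R j) = 0" for j
    by (rule Suc.IH[OF R(2,3)]) (rule Suc.prems, simp add: R)
  ultimately show ?case by (cases k) (simp_all add: R)
qed

text \<open>Splitting off a root \<open>r < 0\<close> leaves a factor \<open>z - r\<close> with
  positive coefficients, and such products keep all coefficients up to the leading one
  positive.\<close>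

lemma negative_rooted_coeffs_pos:
  fixes Q :: "complex poly"
  assumes "degree Q \<le> n" "coeff Q n = 1" "\<And>z. poly Q z = 0 \<Longrightarrow> Im z = 0 \<and> Re z < 0" "k \<le> n"
  shows "0 < Re (coeff Q k)"
  using assms
proof (induction n arbitrary: Q k)
  case 0
  then show ?case by simp
next
  case (Suc n)
  obtain r R where R: "Q = [:- r, 1:] * R" "degree R \<le> n" "coeff R n = 1"
    using monic_factor Suc.prems by metis
  have r: "Im r = 0" "Re r < 0" using Suc.prems(3)[of r] by (simp_all add: R)
  have root: "poly R z = 0 \<Longrightarrow> Im z = 0 \<and> Re z < 0" for z
    by (rule Suc.prems) (simp add: R)
  have pos: "j \<le> n \<Longrightarrow> 0 < Re (coeff R j)" for j
    by (rule Suc.IH[OF R(2,3) root])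
  show ?case
  proof (cases k)
    case 0
    then show ?thesis using r pos[of 0] by (simp add: R mult_neg_pos)
  next
    case (Suc j)
    have "0 \<le> - Re r * Re (coeff R k)"
      using r pos[of k] Suc.prems(4) R(2)
      by (cases "k \<le> n") (auto simp: coeff_eq_0 mult_nonpos_nonneg less_imp_le)
    then show ?thesis using r pos[of j] Suc.prems(4) Suc by (simp add: R)
  qed
qed

lemma nonneg_coeffs_pos:
  fixes Q :: "complex poly" and y :: real
  assumes "\<And>k. 0 \<le> Re (coeff Q k)" "\<And>k. Im (coeff Q k) = 0" "0 < Re (coeff Q 0)" "0 \<le> y"
  shows "0 < Re (poly Q (of_real y))"
proof -
  have "Re (poly Q (of_real y)) = (\<Sum>k\<le>degree Q. Re (coeff Q k) * y ^ k)"
    by (simp add: poly_altdef flip: of_real_power)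
  also have "\<dots> \<ge> (\<Sum>k\<in>{0}. Re (coeff Q k) * y ^ k)"
    by (rule sum_mono2) (use assms in auto)
  finally show ?thesis using assms by simp
qed

text \<open>Along a segment of monic real-rooted polynomials that do not vanish at \<open>b\<close>, no root can pass
  to the right of \<open>b\<close>: the Taylor coefficients at \<open>b\<close> start out positive, and they are all positive
  again at the first moment when one of them would vanish.\<close>
lemma real_rooted_segment_pos:
  fixes P Q :: "complex poly" and b :: real
  assumes P: "degree P \<le> n" "coeff P n = 1" and Q: "degree Q \<le> n" "coeff Q n = 1"
    and rooted: "\<And>s z. 0 \<le> s \<Longrightarrow> s \<le> 1 \<Longrightarrow> of_real (1 - s) * poly P z + of_real s * poly Q z = 0 \<Longrightarrow> Im z = 0"
    and pos: "\<And>x. b \<le> x \<Longrightarrow> 0 < Re (poly P (of_real x))"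
    and "0 < Re (poly Q (of_real b))" and "b \<le> x"
  shows "0 < Re (poly Q (of_real x))"
proof -
  define T where "T s = pcompose (smult (of_real (1 - s)) P + smult (of_real s) Q) [:of_real b, 1:]" for s :: real
  have polyT: "poly (T s) z = of_real (1 - s) * poly P (of_real b + z) + of_real s * poly Q (of_real b + z)" for s z
    by (simp add: T_def poly_pcompose)
  define U where "U s = smult (of_real (1 - s)) P + smult (of_real s) Q" for s :: real
  have U: "degree (U s) \<le> n" "coeff (U s) n = 1" for s
    unfolding U_def using P Q
    by (auto intro!: degree_add_le intro: order_trans[OF degree_smult_le])
  have dU: "degree (U s) = n" for s using U[of s] by (auto intro!: antisym le_degree)
  have T: "degree (T s) \<le> n" "coeff (T s) n = 1" for s
  proof -
    have "degree (T s) = n" using dU[of s] by (simp add: T_def U_def degree_pcompose)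
    moreover have "lead_coeff (T s) = 1"
      unfolding T_def U_def[symmetric] using U dU by (subst lead_coeff_comp) auto
    ultimately show "degree (T s) \<le> n" "coeff (T s) n = 1" by auto
  qed
  have Tim: "Im z = 0" if "0 \<le> s" "s \<le> 1" "poly (T s) z = 0" for s z
    using rooted[of s "of_real b + z"] that by (simp add: polyT)
  have Tre: "Im (coeff (T s) k) = 0" if "0 \<le> s" "s \<le> 1" for s k
    using real_rooted_coeffs_real[OF T] Tim that by blast
  have Tlin: "coeff (T s) k = of_real (1 - s) * coeff (T 0) k + of_real s * coeff (T 1) k" for s k
    by (simp add: T_def pcompose_add pcompose_smult)
  define a where "a k = Re (coeff (T 0) k)" for k
  define c where "c k = Re (coeff (T 1) k)" for k
  have lin: "Re (coeff (T s) k) = (1 - s) * a k + s * c k" for s k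
    by (subst Tlin) (simp add: a_def c_def)
  have a: "0 < a k" if "k \<le> n" for k
  proof -
    have "Im z = 0 \<and> Re z < 0" if "poly (T 0) z = 0" for z
    proof
      show im: "Im z = 0" using Tim[of 0 z] that by simp
      show "Re z < 0"
      proof (rule ccontr)
        assume "\<not> Re z < 0"
        then have "0 < Re (poly P (of_real (b + Re z)))" by (intro pos) simp
        moreover have "of_real (b + Re z) = of_real b + z" using im by (simp add: complex_eq_iff)
        ultimately show False using that by (simp add: polyT)
      qed
    qed
    then show ?thesis unfolding a_def using negative_rooted_coeffs_pos[OF T] that by blast
  qed
  have c0: "0 < c 0"
    using assms(7) polyT[of 1 0] by (simp add: c_def poly_0_coeff_0)
  have c: "0 < c k" if "k \<le> n" for k
  proof (rule ccontr)
    assume "\<not> 0 < c k"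
    \<comment> \<open>\<open>a k / (a k - c k)\<close> is the time \<open>s\<close> at which the
      coefficient \<open>(1 - s) * a k + s * c k\<close> vanishes; the minimum is the first such
      time.\<close>
    define S where "S = (\<lambda>k. a k / (a k - c k)) ` {k. k \<le> n \<and> c k \<le> 0}"
    have S: "finite S" "S \<noteq> {}" using \<open>\<not> 0 < c k\<close> that by (auto simp: S_def)
    define s where "s = Min S"
    obtain j where j: "j \<le> n" "c j \<le> 0" "s = a j / (a j - c j)"
      using Min_in[OF S] by (auto simp: s_def S_def)
    have s: "0 < s" "s \<le> 1" using j(2) a[OF j(1)] unfolding j(3) by simp_all
    have nonneg: "0 \<le> Re (coeff (T s) i)" for i
    proof (cases "i \<le> n")
      case True
      show ?thesis
      proof (cases "c i \<le> 0")
        case True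
        then have "s \<le> a i / (a i - c i)"
          unfolding s_def using S \<open>i \<le> n\<close> by (intro Min_le) (auto simp: S_def)
        then have "s * (a i - c i) \<le> a i" using a[OF \<open>i \<le> n\<close>] True by (simp add: field_simps)
        then show ?thesis by (simp add: lin algebra_simps)
      next
        case False
        then show ?thesis using a[OF \<open>i \<le> n\<close>] s by (simp add: lin)
      qed
    next
      case False
      then show ?thesis using T(1)[of s] by (simp add: coeff_eq_0)
    qed
    have "0 < Re (coeff (T s) 0)"
      using a[of 0] c0 s by (simp add: lin add_nonneg_pos)
    then have Tpos: "0 < Re (poly (T s) (of_real y))" if "0 \<le> y" for y
      using nonneg_coeffs_pos[of "T s" y] nonneg Tre s that by simp
    have "0 < Re (coeff (T s) j)"
    proof (rule negative_rooted_coeffs_pos[OF T _ j(1)])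
      fix z assume z: "poly (T s) z = 0"
      have im: "Im z = 0" using Tim[of s z] s z by simp
      then have "of_real (Re z) = z" by (simp add: complex_eq_iff)
      then have "Re z < 0" using Tpos[of "Re z"] z by force
      with im show "Im z = 0 \<and> Re z < 0" by simp
    qed
    moreover have "Re (coeff (T s) j) = 0"
      using j a[of j] by (simp add: lin field_simps)
    ultimately show False by simp
  qed
  have "0 < Re (poly (T 1) (of_real (x - b)))"
  proof (rule nonneg_coeffs_pos)
    show "0 \<le> Re (coeff (T 1) k)" for k
      using c[of k] T(1)[of 1] by (cases "k \<le> n") (simp_all add: c_def coeff_eq_0 less_imp_le)
  qed (use Tre c0 \<open>b \<le> x\<close> in \<open>auto simp: c_def\<close>)
  then show ?thesis by (simp add: polyT)
qed

text \<open>A positive average at \<open>b\<close> makes one branch positive at \<open>b\<close>.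
  The segment from the average to that branch consists of convex combinations of the two branches,
  which are real-rooted, so \<open>real_rooted_segment_pos\<close> carries positivity to all
  \<open>x \<ge> b\<close>.\<close>

lemma mixdet_choice:
  fixes S :: "real ^ 'n ^ 'n" and v :: "real ^ 'n" and u :: "'i \<Rightarrow> real ^ 'n" and l :: "'i list"
  assumes p: "\<And>i. 0 \<le> p i \<and> p i \<le> 1" and r: "0 \<le> r" "r \<le> 1" and sym: "transpose S = S"
  defines "F \<equiv> \<lambda>S x. mixdet p u l (mat x + S) (mat x - S)"
  assumes pos: "\<And>x. b \<le> x \<Longrightarrow> 0 < r * F (S + rk1 (1 - r) v) x + (1 - r) * F (S - rk1 r v) x"
  shows "(\<forall>x\<ge>b. 0 < F (S + rk1 (1 - r) v) x) \<or> (\<forall>x\<ge>b. 0 < F (S - rk1 r v) x)"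
proof -
  define G where "G S z = mixdet p u l (mat z + cmat S) (mat z + cmat (- S))" for S z
  have GF: "G S (of_real x) = of_real (F S x)" for S x
    unfolding G_def F_def cmat_mat[symmetric] cmat_add[symmetric] mixdet_cmat by simp
  have Gcnj: "G S (cnj z) = cnj (G S z)" for S z
    unfolding G_def mixdet_mcnj[symmetric] by (simp add: mcnj_simps)
  let ?S1 = "S + rk1 (1 - r) v" and ?S0 = "S - rk1 r v"
  have up: "of_real s * G ?S1 z + (1 - of_real s) * G ?S0 z \<noteq> 0"
    if s: "0 \<le> s" "s \<le> 1" and z: "0 < Im z" for s z
  proof -
    \<comment> \<open>Recentering at \<open>T\<close> makes the two-point average of weight
      \<open>s\<close> hit the same two branches \<open>?S1\<close> and \<open>?S0\<close> for every
      \<open>s\<close>.\<close>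
    define T where "T = S + rk1 (s - r) v"
    have T: "transpose T = T" by (simp add: T_def transpose_add transpose_rk1 sym)
    then have T': "transpose (- T) = - T" by (simp add: transpose_def vec_eq_iff)
    have diss: "dissipative (mat z + cmat T)" "dissipative (mat z + cmat (- T))"
      using z T T' by (auto intro!: dissipative_add_herm cmat_form_real)
    have 1: "mat z + cmat T + rk1 (1 - of_real s) v = mat z + cmat ?S1"
      "mat z + cmat (- T) - rk1 (1 - of_real s) v = mat z + cmat (- ?S1)"
      "mat z + cmat T - rk1 (of_real s) v = mat z + cmat ?S0"
      "mat z + cmat (- T) + rk1 (of_real s) v = mat z + cmat (- ?S0)"
      by (simp_all add: T_def vec_eq_iff algebra_simps)
    show ?thesis
      using average_dissipative_nz[OF mixdet_dissipative_nz[where p = p, OF p] s diss, where u = u and l = l and v = v]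
      unfolding 1 G_def by simp
  qed
  have rooted: "Im z = 0"
    if "0 \<le> s" "s \<le> 1" "of_real s * G ?S1 z + (1 - of_real s) * G ?S0 z = 0" for s z
  proof (rule ccontr)
    assume "Im z \<noteq> 0"
    then consider "0 < Im z" | "0 < Im (cnj z)" by fastforce
    then show False
    proof cases
      case 2
      have "of_real s * G ?S1 (cnj z) + (1 - of_real s) * G ?S0 (cnj z)
          = cnj (of_real s * G ?S1 z + (1 - of_real s) * G ?S0 z)"
        by (simp add: Gcnj)
      then show False using up[OF that(1,2) 2] that(3) by simp
    qed (use up that in blast)
  qed
  let ?n = "2 * CARD('n)"
  obtain Q1 where Q1: "degree Q1 \<le> ?n" "coeff Q1 ?n = 1" "\<And>z. poly Q1 z = G ?S1 z"
    unfolding G_def using mixdet_monic_poly by metis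
  obtain Q0 where Q0: "degree Q0 \<le> ?n" "coeff Q0 ?n = 1" "\<And>z. poly Q0 z = G ?S0 z"
    unfolding G_def using mixdet_monic_poly by metis
  define P where "P = smult (of_real r) Q1 + smult (of_real (1 - r)) Q0"
  have P: "degree P \<le> ?n" "coeff P ?n = 1"
    unfolding P_def using Q0 Q1
    by (auto intro!: degree_add_le intro: order_trans[OF degree_smult_le])
  have polyP: "poly P z = of_real r * G ?S1 z + (1 - of_real r) * G ?S0 z" for z
    by (simp add: P_def Q0 Q1)
  have Ppos: "0 < Re (poly P (of_real x))" if "b \<le> x" for x
    using pos[OF that] by (simp add: polyP GF)
  \<comment> \<open>These are the weights of \<open>?S1\<close> at a point of the segment from the
    average towards \<open>?S1\<close> and towards \<open>?S0\<close> respectively.\<close>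
  have ineq: "0 \<le> s + (1 - s) * r" "s + (1 - s) * r \<le> 1" "0 \<le> (1 - s) * r" "(1 - s) * r \<le> 1"
    if "0 \<le> s" "s \<le> 1" for s
  proof -
    have "(1 - s) * r \<le> (1 - s) * 1" using r that by (intro mult_left_mono) auto
    then show "s + (1 - s) * r \<le> 1" "(1 - s) * r \<le> 1" using that by auto
    show "0 \<le> (1 - s) * r" using r that by simp
    then show "0 \<le> s + (1 - s) * r" using that by simp
  qed
  consider "0 < F ?S1 b" | "0 < F ?S0 b"
  proof (cases "0 < F ?S1 b")
    case False
    then have "r * F ?S1 b \<le> 0" using r by (simp add: mult_nonneg_nonpos)
    with pos[of b] have "0 < (1 - r) * F ?S0 b" by simp
    then have "0 < F ?S0 b" using r by (simp add: zero_less_mult_iff)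
    then show ?thesis using that by simp
  qed
  then show ?thesis
  proof cases
    case 1
    have "0 < Re (poly Q1 (of_real x))" if "b \<le> x" for x
    proof (rule real_rooted_segment_pos[OF P Q1(1,2) _ Ppos _ that])
      fix s :: real and z
      assume s: "0 \<le> s" "s \<le> 1" and "of_real (1 - s) * poly P z + of_real s * poly Q1 z = 0"
      then have "of_real (s + (1 - s) * r) * G ?S1 z + (1 - of_real (s + (1 - s) * r)) * G ?S0 z = 0"
        by (simp add: polyP Q1 algebra_simps)
      then show "Im z = 0" using ineq[OF s] rooted[of "s + (1 - s) * r" z] by simp
    qed (use 1 in \<open>simp_all add: Q1 GF\<close>)
    then show ?thesis by (simp add: Q1 GF)
  next
    case 2
    have "0 < Re (poly Q0 (of_real x))" if "b \<le> x" for x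
    proof (rule real_rooted_segment_pos[OF P Q0(1,2) _ Ppos _ that])
      fix s :: real and z
      assume s: "0 \<le> s" "s \<le> 1" and "of_real (1 - s) * poly P z + of_real s * poly Q0 z = 0"
      then have "of_real ((1 - s) * r) * G ?S1 z + (1 - of_real ((1 - s) * r)) * G ?S0 z = 0"
        by (simp add: polyP Q0 algebra_simps)
      then show "Im z = 0" using ineq[OF s] rooted[of "(1 - s) * r" z] by simp
    qed (use 2 in \<open>simp_all add: Q0 GF\<close>)
    then show ?thesis by (simp add: Q0 GF)
  qed
qed

text \<open>The values are fixed one at a time, following a branch from
  \<open>mixdet_choice\<close>. Positivity is carried on the whole ray because the next choice again
  needs it there.\<close>

lemma mixdet_select:
  fixes S :: "real ^ 'n ^ 'n"
  assumes p: "\<And>i. 0 \<le> p i \<and> p i \<le> 1" and "distinct l" "transpose S = S"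
    and "\<forall>x\<ge>b. 0 < mixdet p u l (mat x + S) (mat x - S)"
  shows "\<exists>z. (\<forall>i. z i \<in> {0, 1}) \<and> (\<forall>x\<ge>b.
    0 < det (mat x + (S + (\<Sum>i\<leftarrow>l. rk1 (z i - p i) (u i)))) * det (mat x - (S + (\<Sum>i\<leftarrow>l. rk1 (z i - p i) (u i)))))"
  using assms(2-)
proof (induction l arbitrary: S)
  case Nil
  then show ?case by (intro exI[of _ "\<lambda>_. 0"]) simp
next
  case (Cons i l)
  have "\<exists>e\<in>{0, 1}. \<forall>x\<ge>b. 0 < mixdet p u l (mat x + (S + rk1 (e - p i) (u i))) (mat x - (S + rk1 (e - p i) (u i)))"
  proof -
    have "0 < p i * mixdet p u l (mat x + (S + rk1 (1 - p i) (u i))) (mat x - (S + rk1 (1 - p i) (u i)))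
        + (1 - p i) * mixdet p u l (mat x + (S - rk1 (p i) (u i))) (mat x - (S - rk1 (p i) (u i)))"
      if "b \<le> x" for x
      using Cons.prems(3)[rule_format, OF that] by (simp add: algebra_simps)
    from mixdet_choice[where p = p, OF p _ _ Cons.prems(2) this] p[of i]
    consider "\<forall>x\<ge>b. 0 < mixdet p u l (mat x + (S + rk1 (1 - p i) (u i))) (mat x - (S + rk1 (1 - p i) (u i)))"
      | "\<forall>x\<ge>b. 0 < mixdet p u l (mat x + (S - rk1 (p i) (u i))) (mat x - (S - rk1 (p i) (u i)))"
      by blast
    then show ?thesis
    proof cases
      case 1
      then show ?thesis by blast
    next
      case 2
      have "S - rk1 (p i) (u i) = S + rk1 (0 - p i) (u i)" by (simp add: rk1_minus)
      with 2 show ?thesis by (intro bexI[of _ 0]) (simp_all only: insert_iff simp_thms)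
    qed
  qed
  then obtain e where e: "e \<in> {0, 1}"
    "\<forall>x\<ge>b. 0 < mixdet p u l (mat x + (S + rk1 (e - p i) (u i))) (mat x - (S + rk1 (e - p i) (u i)))"
    by blast
  have sym: "transpose (S + rk1 (e - p i) (u i)) = S + rk1 (e - p i) (u i)"
    using Cons.prems(2) by (simp add: transpose_add transpose_rk1)
  have dist: "distinct l" using Cons.prems(1) by simp
  from Cons.IH[OF dist sym e(2)] obtain z where z: "(\<forall>i. z i \<in> {0, 1}) \<and>
    (\<forall>x\<ge>b. 0 < det (mat x + (S + rk1 (e - p i) (u i) + (\<Sum>i\<leftarrow>l. rk1 (z i - p i) (u i))))
       * det (mat x - (S + rk1 (e - p i) (u i) + (\<Sum>i\<leftarrow>l. rk1 (z i - p i) (u i)))))"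
    by (elim exE)
  have "map (\<lambda>j. rk1 ((z(i := e)) j - p j) (u j)) l = map (\<lambda>j. rk1 (z j - p j) (u j)) l"
    using Cons.prems(1) by auto
  then have eq: "(\<Sum>j\<leftarrow>l. rk1 ((z(i := e)) j - p j) (u j)) = (\<Sum>j\<leftarrow>l. rk1 (z j - p j) (u j))"
    by (simp only:)
  have sum_eq: "S + (\<Sum>j\<leftarrow>i # l. rk1 ((z(i := e)) j - p j) (u j))
      = S + rk1 (e - p i) (u i) + (\<Sum>j\<leftarrow>l. rk1 (z j - p j) (u j))"
    by (simp add: eq add.assoc fun_upd_same del: fun_upd_apply)
  show ?case
  proof (intro exI conjI)
    show "\<forall>j. (z(i := e)) j \<in> {0, 1}" using z e(1) by simp
    show "\<forall>x\<ge>b. 0 < det (mat x + (S + (\<Sum>j\<leftarrow>i # l. rk1 ((z(i := e)) j - p j) (u j))))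
       * det (mat x - (S + (\<Sum>j\<leftarrow>i # l. rk1 ((z(i := e)) j - p j) (u j))))"
      unfolding sum_eq using z by (rule conjunct2)
  qed
qed

subsection \<open>Rank-one discrepancy\<close>

text \<open>A zero of a nonnegative form is a minimum, so the gradient vanishes there: otherwise a
  small step against \<open>A *v v\<close> would make the form negative.\<close>

lemma pos_semidef_null:
  assumes A: "pos_semidef A" and v: "v \<bullet> (A *v v) = 0"
  shows "A *v v = 0"
proof (rule ccontr)
  assume "A *v v \<noteq> 0"
  define w where "w = A *v v"
  define c where "c = w \<bullet> (A *v w)"
  \<comment> \<open>The form at \<open>v + t w\<close> is
    \<open>2 t (w \<bullet> w) + t^2 c\<close>. This \<open>t\<close> turns it into
    \<open>t (w \<bullet> w) - t^2 < 0\<close>, and \<open>c + 1\<close> keeps the denominator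
    positive.\<close>
  define t where "t = - (w \<bullet> w) / (c + 1)"
  have w: "0 < w \<bullet> w" using \<open>A *v v \<noteq> 0\<close> by (simp add: w_def)
  have c: "0 \<le> c" using A by (simp add: c_def pos_semidef_def)
  have "v v* A = transpose A *v v" by simp
  also have "\<dots> = w" using A by (simp only: pos_semidef_def w_def)
  finally have "v \<bullet> (A *v w) = w \<bullet> w" by (simp only: dot_lmul_matrix[symmetric])
  then have "(v + t *\<^sub>R w) \<bullet> (A *v (v + t *\<^sub>R w)) = 2 * t * (w \<bullet> w) + t\<^sup>2 * c"
    using v by (simp add: matrix_vector_right_distrib matrix_vector_mult_scaleR inner_add_left inner_add_right
      c_def power2_eq_square algebra_simps flip: w_def)
  moreover have "0 \<le> (v + t *\<^sub>R w) \<bullet> (A *v (v + t *\<^sub>R w))"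
    using A by (simp add: pos_semidef_def)
  moreover have "t * c = - (w \<bullet> w) - t" using c by (simp add: t_def field_simps)
  then have "t * (t * c) = t * (- (w \<bullet> w) - t)" by simp
  then have "t\<^sup>2 * c = - t * (w \<bullet> w) - t\<^sup>2" by (simp add: power2_eq_square algebra_simps del: mult_cancel_left)
  ultimately have "0 \<le> t * (w \<bullet> w) - t\<^sup>2" by (simp add: algebra_simps)
  moreover have "t < 0" using w c by (simp add: t_def divide_neg_pos)
  then have "t * (w \<bullet> w) < 0" using w by (rule mult_neg_pos)
  ultimately show False using zero_le_power2[of t] by linarith
qed

text \<open>Let \<open>m\<close> be the maximum of the form on the unit sphere, attained at
  \<open>v\<close>. Then \<open>mat m - M\<close> is positive semidefinite and kills
  \<open>v\<close>, so its determinant is zero and \<open>m < b\<close>.\<close>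

lemma quadratic_form_le:
  fixes M :: "real ^ 'n ^ 'n"
  assumes sym: "transpose M = M" and nz: "\<And>x. b \<le> x \<Longrightarrow> det (mat x - M) \<noteq> 0"
  shows "w \<bullet> (M *v w) \<le> b * (w \<bullet> w)"
proof -
  have "continuous_on (sphere 0 1) (\<lambda>y. y \<bullet> (M *v y))"
    by (intro continuous_on_inner continuous_on_id linear_continuous_on matrix_vector_mul_bounded_linear)
  then obtain v where v: "v \<in> sphere 0 1" and max: "\<And>y. y \<in> sphere 0 1 \<Longrightarrow> y \<bullet> (M *v y) \<le> v \<bullet> (M *v v)"
    using continuous_attains_sup[of "sphere 0 1" "\<lambda>y. y \<bullet> (M *v y)"] by auto
  define m where "m = v \<bullet> (M *v v)"
  have le: "y \<bullet> (M *v y) \<le> m * (y \<bullet> y)" for y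
  proof (cases "y = 0")
    case False
    have "(y /\<^sub>R norm y) \<bullet> (M *v (y /\<^sub>R norm y)) \<le> m"
      unfolding m_def using False by (intro max) simp
    then have "(y \<bullet> (M *v y)) / (norm y)\<^sup>2 \<le> m"
      by (simp add: matrix_vector_mult_scaleR power2_eq_square divide_inverse mult_ac)
    then show ?thesis using False by (simp add: field_simps power2_norm_eq_inner)
  qed simp
  have "m < b"
  proof (rule ccontr)
    assume "\<not> m < b"
    then have "det (mat m - M) \<noteq> 0" by (intro nz) simp
    moreover have "pos_semidef (mat m - M)"
      using le by (simp add: pos_semidef_def transpose_diff sym matrix_vector_mult_diff_rdistrib
        inner_diff_right mat_mult_vec)
    moreover have "v \<bullet> ((mat m - M) *v v) = 0"
      using v by (simp add: matrix_vector_mult_diff_rdistrib inner_diff_right mat_mult_vec m_def dot_square_norm)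
    ultimately have "(mat m - M) *v v = 0" "invertible (mat m - M)"
      using pos_semidef_null by (auto simp: invertible_det_nz)
    moreover have "v \<noteq> 0" using v by auto
    ultimately show False
      unfolding invertible_left_inverse matrix_left_invertible_ker by blast
  qed
  then have "m * (w \<bullet> w) \<le> b * (w \<bullet> w)" by (intro mult_right_mono) auto
  then show ?thesis using le[of w] by linarith
qed

lemma sum_rk1_quadratic_form:
  "finite I \<Longrightarrow> y \<bullet> ((\<Sum>i\<in>I. rk1 (s i) (v i)) *v y) = (\<Sum>i\<in>I. s i * (v i \<bullet> y)\<^sup>2)" for s :: "'i \<Rightarrow> real"
  by (induction I rule: finite_induct)
    (simp_all add: matrix_vector_mult_add_rdistrib inner_add_right rk1_quadratic_form)

text \<open>Selection starts at \<open>S = 0\<close>. The selected \<open>M\<close> has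
  \<open>det (x + M)\<close> and \<open>det (x - M)\<close> nonzero for all
  \<open>x \<ge> b\<close>, which bounds the forms of both \<open>M\<close> and
  \<open>- M\<close>.\<close>

theorem rank_one_discrepancy:
  fixes u :: "'i::finite \<Rightarrow> real ^ 'n"
  assumes p: "\<And>i. 0 \<le> p i \<and> p i \<le> 1" and "0 < \<sigma>" "3 * \<sigma> < b"
    and var: "\<And>w. (\<Sum>i\<in>UNIV. p i * (1 - p i) * (u i \<bullet> u i) * (u i \<bullet> w)\<^sup>2) \<le> \<sigma>\<^sup>2 * (w \<bullet> w)"
  shows "\<exists>z. (\<forall>i. z i \<in> {0, 1}) \<and> (\<forall>w. \<bar>\<Sum>i\<in>UNIV. (z i - p i) * (u i \<bullet> w)\<^sup>2\<bar> \<le> b * (w \<bullet> w))"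
proof -
  obtain l :: "'i list" where l: "set l = UNIV" "distinct l"
    using finite_distinct_list[OF finite[of "UNIV :: 'i set"]] by blast
  have pos: "\<forall>x\<ge>b. 0 < mixdet p u l (mat x + 0) (mat x - 0)"
    using mixdet_mat_pos[where p = p, OF p \<open>0 < \<sigma>\<close>, where l = l and u = u] \<open>3 * \<sigma> < b\<close> var l
    by (simp add: sum_list_distinct_conv_sum_set)
  have zero: "transpose (0 :: real ^ 'n ^ 'n) = 0" by (simp add: transpose_def vec_eq_iff)
  define M where "M z = (\<Sum>i\<in>UNIV. rk1 (z i - p i) (u i))" for z
  have sum: "0 + (\<Sum>i\<leftarrow>l. rk1 (z i - p i) (u i)) = M z" for z
    using l by (simp add: M_def sum_list_distinct_conv_sum_set)
  from mixdet_select[where p = p and b = b, OF p l(2) zero pos, unfolded sum]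
  obtain z where z: "(\<forall>i. z i \<in> {0, 1}) \<and> (\<forall>x\<ge>b. 0 < det (mat x + M z) * det (mat x - M z))"
    by (elim exE)
  have "transpose (M z) = M z" "transpose (- M z) = - M z"
    by (simp_all add: M_def transpose_def vec_eq_iff mult.commute)
  moreover have "det (mat x - M z) \<noteq> 0" "det (mat x - (- M z)) \<noteq> 0" if "b \<le> x" for x
  proof -
    have "0 < det (mat x + M z) * det (mat x - M z)" using z that by blast
    then show "det (mat x - M z) \<noteq> 0" "det (mat x - (- M z)) \<noteq> 0" by auto
  qed
  ultimately have le: "w \<bullet> (M z *v w) \<le> b * (w \<bullet> w)" "w \<bullet> ((- M z) *v w) \<le> b * (w \<bullet> w)" for w
    by (simp_all add: quadratic_form_le)
  have "\<bar>\<Sum>i\<in>UNIV. (z i - p i) * (u i \<bullet> w)\<^sup>2\<bar> \<le> b * (w \<bullet> w)" for w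
  proof -
    have "w \<bullet> (M z *v w) = (\<Sum>i\<in>UNIV. (z i - p i) * (u i \<bullet> w)\<^sup>2)"
      unfolding M_def by (rule sum_rk1_quadratic_form) simp
    moreover have "(- M z) *v w = - (M z *v w)"
      using matrix_vector_mult_diff_rdistrib[of 0 "M z" w] by simp
    ultimately show ?thesis using le[of w] by (simp add: abs_le_iff)
  qed
  with z show ?thesis by blast
qed

section \<open>Appending the cost coordinate and deducing the theorem\<close>

lemma outer_self_eq_rk1: "outer_self v = rk1 1 v"
  by (simp add: outer_self_def columnvector_def rowvector_def matrix_matrix_mult_def vec_eq_iff)

lemma scaleR_outer_self: "s *\<^sub>R outer_self v = rk1 s v"
  by (simp add: outer_self_eq_rk1 vec_eq_iff)

definition vec_snoc :: "real ^ 'n \<Rightarrow> real \<Rightarrow> real ^ ('n option)" where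
  "vec_snoc y t = (\<chi> k. case k of None \<Rightarrow> t | Some j \<Rightarrow> y $ j)"

lemma sum_option: "(\<Sum>k\<in>(UNIV :: 'n::finite option set). f k) = f None + (\<Sum>j\<in>UNIV. f (Some j))"
  by (simp add: UNIV_option_conv sum.reindex)

lemma inner_vec_snoc: "vec_snoc y t \<bullet> vec_snoc y' t' = y \<bullet> y' + t * t'"
  by (simp add: inner_vec_def sum_option vec_snoc_def)

lemma vec_snoc_surj: "\<exists>y t. w = vec_snoc y t"
  by (intro exI[of _ "\<chi> j. w $ Some j"] exI[of _ "w $ None"])
    (simp add: vec_eq_iff vec_snoc_def split: option.split)

theorem theorem1p9:
  fixes v :: "'m::finite \<Rightarrow> real ^ 'n"
    and x c :: "real ^ 'm"
    and \<epsilon> :: real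
  assumes "\<forall>i. 0 \<le> x $ i \<and> x $ i \<le> 1"
    and "\<forall>i. 0 \<le> c $ i"
    and "(\<Sum>i\<in>UNIV. (x $ i) *\<^sub>R outer_self (v i)) = mat 1"
    and "\<forall>i. norm (v i) \<le> \<epsilon>"
    and "\<epsilon> < 1 / 8"
    and "Max (range (\<lambda>i. c $ i)) \<le> \<epsilon>\<^sup>2 * (c \<bullet> x)"
  shows "\<exists>z :: real ^ 'm. (\<forall>i. z $ i \<in> {0, 1}) \<and>
    (1 - 8 * \<epsilon>) *\<^sub>R mat 1 \<preceq> (\<Sum>i\<in>UNIV. (z $ i) *\<^sub>R outer_self (v i)) \<and>
    (\<Sum>i\<in>UNIV. (z $ i) *\<^sub>R outer_self (v i)) \<preceq> (1 + 8 * \<epsilon>) *\<^sub>R mat 1 \<and>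
    (1 - 8 * \<epsilon>) * (c \<bullet> x) \<le> c \<bullet> z \<and>
    c \<bullet> z \<le> (1 + 8 * \<epsilon>) * (c \<bullet> x)"
proof -
  have x: "0 \<le> x $ i" "x $ i \<le> 1" and c: "0 \<le> c $ i" for i
    using assms(1,2) by auto
  have cx: "c \<bullet> x = (\<Sum>i\<in>UNIV. c $ i * x $ i)" by (simp add: inner_vec_def)
  have cx0: "0 \<le> c \<bullet> x" unfolding cx using c x by (intro sum_nonneg) auto
  have iso: "(\<Sum>i\<in>UNIV. x $ i * (v i \<bullet> y)\<^sup>2) = y \<bullet> y" for y
    using sum_rk1_quadratic_form[of UNIV y "\<lambda>i. x $ i" v] assms(3)
    by (simp add: scaleR_outer_self mat_mult_vec)
  \<comment> \<open>Positivity is needed for \<open>\<sigma> = 2 * \<epsilon>\<close>; otherwise all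
    \<open>v i\<close> vanish and cannot sum to the identity.\<close>
  have "0 < \<epsilon>"
  proof (rule ccontr)
    assume "\<not> 0 < \<epsilon>"
    then have "v i = 0" for i using assms(4) by (metis norm_le_zero_iff not_less order_trans)
    then have "(axis k 1 :: real ^ 'n) \<bullet> axis k 1 = 0" for k using iso[of "axis k 1"] by simp
    then show False by (simp add: inner_axis_axis)
  qed
  \<comment> \<open>If \<open>c \<bullet> x = 0\<close>, division by zero makes
    \<open>s i = 0\<close>; the cost bound is then proved separately, since all \<open>c $ i\<close>
    vanish.\<close>
  define s where "s i = sqrt (c $ i / (c \<bullet> x))" for i
  have s2: "(s i)\<^sup>2 = c $ i / (c \<bullet> x)" for i using c cx0 by (simp add: s_def)
  have s_le: "(s i)\<^sup>2 \<le> \<epsilon>\<^sup>2" for i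
  proof -
    have "c $ i \<le> Max (range (\<lambda>i. c $ i))" by (intro Max_ge) auto
    then have "c $ i \<le> \<epsilon>\<^sup>2 * (c \<bullet> x)" using assms(6) by linarith
    then show ?thesis unfolding s2 using cx0 by (cases "c \<bullet> x = 0") (simp_all add: divide_le_eq)
  qed
  have ratio: "(\<Sum>i\<in>UNIV. f i * (s i)\<^sup>2) = (\<Sum>i\<in>UNIV. c $ i * f i) / (c \<bullet> x)" for f
    unfolding s2 sum_divide_distrib by (simp add: mult.commute)
  have s_sum: "(\<Sum>i\<in>UNIV. x $ i * (s i)\<^sup>2) \<le> 1"
    unfolding ratio cx[symmetric] by simp
  define u where "u i = vec_snoc (v i) (s i)" for i
  have u_le: "u i \<bullet> u i \<le> 2 * \<epsilon>\<^sup>2" for i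
  proof -
    have "v i \<bullet> v i \<le> \<epsilon>\<^sup>2"
      using assms(4) by (metis norm_ge_zero power2_norm_eq_inner power_mono)
    then show ?thesis using s_le[of i] by (simp add: u_def inner_vec_snoc power2_eq_square)
  qed
  \<comment> \<open>One factor 2 comes from the norm of \<open>u i\<close>, the other from
    \<open>(a + b)^2 \<le> 2 (a^2 + b^2)\<close>, which removes the cross term between vector and
    cost.\<close>
  have var: "(\<Sum>i\<in>UNIV. x $ i * (1 - x $ i) * (u i \<bullet> u i) * (u i \<bullet> w)\<^sup>2) \<le> (2 * \<epsilon>)\<^sup>2 * (w \<bullet> w)" for w
  proof -
    obtain y t where w: "w = vec_snoc y t" using vec_snoc_surj by blast
    have "x $ i * (1 - x $ i) * (u i \<bullet> u i) * (u i \<bullet> w)\<^sup>2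
        \<le> 4 * \<epsilon>\<^sup>2 * (x $ i * (v i \<bullet> y)\<^sup>2 + x $ i * (s i)\<^sup>2 * t\<^sup>2)" for i
    proof -
      have "0 \<le> (v i \<bullet> y - s i * t)\<^sup>2" by simp
      then have "(u i \<bullet> w)\<^sup>2 \<le> 2 * ((v i \<bullet> y)\<^sup>2 + (s i)\<^sup>2 * t\<^sup>2)"
        by (simp add: u_def w inner_vec_snoc power2_eq_square algebra_simps)
      moreover have "x $ i * (1 - x $ i) \<le> x $ i" using x[of i] by (simp add: algebra_simps)
      ultimately have "x $ i * (1 - x $ i) * (u i \<bullet> u i) * (u i \<bullet> w)\<^sup>2
          \<le> x $ i * (2 * \<epsilon>\<^sup>2) * (2 * ((v i \<bullet> y)\<^sup>2 + (s i)\<^sup>2 * t\<^sup>2))"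
        using x[of i] u_le[of i] by (intro mult_mono) auto
      then show ?thesis by (simp add: algebra_simps)
    qed
    then have "(\<Sum>i\<in>UNIV. x $ i * (1 - x $ i) * (u i \<bullet> u i) * (u i \<bullet> w)\<^sup>2)
        \<le> (\<Sum>i\<in>UNIV. 4 * \<epsilon>\<^sup>2 * (x $ i * (v i \<bullet> y)\<^sup>2 + x $ i * (s i)\<^sup>2 * t\<^sup>2))"
      by (rule sum_mono)
    also have "\<dots> = 4 * \<epsilon>\<^sup>2 * (y \<bullet> y + (\<Sum>i\<in>UNIV. x $ i * (s i)\<^sup>2) * t\<^sup>2)"
      by (simp only: sum_distrib_left[symmetric] sum.distrib iso sum_distrib_right[symmetric])
    also have "\<dots> \<le> 4 * \<epsilon>\<^sup>2 * (y \<bullet> y + 1 * t\<^sup>2)"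
      using s_sum by (intro mult_left_mono add_left_mono mult_right_mono) auto
    also have "\<dots> = (2 * \<epsilon>)\<^sup>2 * (w \<bullet> w)"
      by (simp add: w inner_vec_snoc power2_eq_square)
    finally show ?thesis .
  qed
  \<comment> \<open>With \<open>\<sigma> = 2 * \<epsilon>\<close> the requirement is
    \<open>6 * \<epsilon> < 8 * \<epsilon>\<close>. Testing on \<open>(y, 0)\<close> then gives the
    matrix bounds, and testing on \<open>(0, 1)\<close> the cost bound.\<close>
  obtain z where z: "\<And>i. z i \<in> {0, 1}"
    and disc: "\<And>w. \<bar>\<Sum>i\<in>UNIV. (z i - x $ i) * (u i \<bullet> w)\<^sup>2\<bar> \<le> 8 * \<epsilon> * (w \<bullet> w)"
    using rank_one_discrepancy[of "\<lambda>i. x $ i" "2 * \<epsilon>" "8 * \<epsilon>" u] x var \<open>0 < \<epsilon>\<close> by auto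
  have vdisc: "\<bar>(\<Sum>i\<in>UNIV. z i * (v i \<bullet> y)\<^sup>2) - y \<bullet> y\<bar> \<le> 8 * \<epsilon> * (y \<bullet> y)" for y
    using disc[of "vec_snoc y 0"] iso[of y]
    by (simp add: u_def inner_vec_snoc left_diff_distrib sum_subtractf)
  have "\<bar>\<Sum>i\<in>UNIV. (z i - x $ i) * (s i)\<^sup>2\<bar> \<le> 8 * \<epsilon>"
    using disc[of "vec_snoc 0 1"] by (simp add: u_def inner_vec_snoc)
  then have ratio_le: "\<bar>((\<Sum>i\<in>UNIV. c $ i * z i) - c \<bullet> x) / (c \<bullet> x)\<bar> \<le> 8 * \<epsilon>"
    unfolding ratio by (simp add: right_diff_distrib sum_subtractf cx[symmetric])
  have cdisc: "\<bar>(\<Sum>i\<in>UNIV. c $ i * z i) - c \<bullet> x\<bar> \<le> 8 * \<epsilon> * (c \<bullet> x)"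
  proof (cases "c \<bullet> x = 0")
    case True
    have "c $ i = 0" for i
    proof -
      have "c $ i \<le> Max (range (\<lambda>i. c $ i))" by (intro Max_ge) auto
      then have "c $ i \<le> 0" using assms(6) True by simp
      then show ?thesis using c[of i] by simp
    qed
    then show ?thesis using True by simp
  next
    case False
    with cx0 have "0 < c \<bullet> x" by simp
    then show ?thesis using ratio_le by (simp add: abs_divide divide_le_eq)
  qed
  define Z where "Z = (\<chi> i. z i)"
  have Zsum: "(\<Sum>i\<in>UNIV. (Z $ i) *\<^sub>R outer_self (v i)) = (\<Sum>i\<in>UNIV. rk1 (z i) (v i))" (is "?M = _")
    by (simp add: Z_def scaleR_outer_self)
  have sym: "transpose ?M = ?M"
    unfolding Zsum by (simp add: transpose_def vec_eq_iff mult.commute)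
  have form: "y \<bullet> (?M *v y) = (\<Sum>i\<in>UNIV. z i * (v i \<bullet> y)\<^sup>2)" for y
    unfolding Zsum by (simp add: sum_rk1_quadratic_form)
  have mat: "k *\<^sub>R mat 1 = (mat k :: real ^ 'n ^ 'n)" for k
    by (simp add: mat_def vec_eq_iff)
  have "(1 - 8 * \<epsilon>) *\<^sub>R mat 1 \<preceq> ?M"
    unfolding mat loewner_le_def pos_semidef_def
  proof (intro conjI allI)
    show "0 \<le> y \<bullet> ((?M - mat (1 - 8 * \<epsilon>)) *v y)" for y
      using vdisc[of y] unfolding matrix_vector_mult_diff_rdistrib inner_diff_right form mat_mult_vec
      by (simp add: algebra_simps)
  qed (simp add: transpose_diff sym)
  moreover have "?M \<preceq> (1 + 8 * \<epsilon>) *\<^sub>R mat 1"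
    unfolding mat loewner_le_def pos_semidef_def
  proof (intro conjI allI)
    show "0 \<le> y \<bullet> ((mat (1 + 8 * \<epsilon>) - ?M) *v y)" for y
      using vdisc[of y] unfolding matrix_vector_mult_diff_rdistrib inner_diff_right form mat_mult_vec
      by (simp add: algebra_simps)
  qed (simp add: transpose_diff sym)
  moreover have "c \<bullet> Z = (\<Sum>i\<in>UNIV. c $ i * z i)"
    by (simp add: inner_vec_def Z_def)
  then have "(1 - 8 * \<epsilon>) * (c \<bullet> x) \<le> c \<bullet> Z" "c \<bullet> Z \<le> (1 + 8 * \<epsilon>) * (c \<bullet> x)"
    using cdisc by (simp_all add: algebra_simps)
  moreover have "\<forall>i. Z $ i \<in> {0, 1}" using z by (simp add: Z_def)
  ultimately show ?thesis by blast
qed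

end
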